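(* Let $G$ be a torsion-free abelian group, $R$ a $G$-graded Noetherian ring and $M$ a finitely generated $G$-graded $R$-module. Then the following are equivalent: (1) $M$ is modest. (2) $R/P$ is modest for all $P\in\operatorname{Min}(\operatorname{ann}(M))$. (3) $R/P$ is modest for all homogeneous primes $P\in V(\operatorname{ann}(M))$. (4) $R/\operatorname{ann}(M)$ is modest. (5) The ring $(R/\operatorname{ann}(M))_0$ is Artinian.
   Context: All rings are commutative with identity. A $G$-graded ring is $R=\bigoplus_{g\in G}R_g$ with $R_gR_h\subset R_{g+h}$; a $G$-graded $R$-module is $M=\bigoplus_{g\in G}M_g$ with $R_gM_h\subset M_{g+h}$. A $G$-graded $R$-module $M$ is modest if the length $\ell_{R_0}(M_g)$ is finite for every $g\in G$. $\operatorname{Min}(I)$ is the set of minimal primes over an ideal $I$ and $V(I)$ the set of primes containing $I$. The ideal $\operatorname{ann}(M)$ is homogeneous, and since $G$ is torsion-free its minimal primes are homogeneous, so the quotients $R/P$ above are $G$-graded $R$-modules. $(R/\operatorname{ann}(M))_0$ is the degree-$0$ part of the graded ring $R/\operatorname{ann}(M)$; the zero ring counts as Artinian. *)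

theory Defs
  imports "HOL-Algebra.Ring_Divisibility" "HOL-Algebra.Module" "HOL-Library.Extended_Nat"
begin

section \<open>Torsion-free abelian groups\<close>

text \<open>The grading group is written multiplicatively, as groups are in HOL-Algebra:
  degree \<open>g + h\<close> is \<open>g \<otimes>\<^bsub>G\<^esub> h\<close> and degree \<open>0\<close> is \<open>\<one>\<^bsub>G\<^esub>\<close>.\<close>

locale torsion_free_comm_group = comm_group +
  assumes torsion_free: "\<lbrakk>x \<in> carrier G; 0 < (n::nat); x [^] n = \<one>\<rbrakk> \<Longrightarrow> x = \<one>"


section \<open>Graded rings and graded modules\<close>

text \<open>Unique decomposition: a family \<open>f\<close> of components is a function that is undefined
  outside \<open>I\<close>, and \<open>x\<close> is the sum over its finite support.\<close>

definition internal_direct_sum ::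
    "('b, 'n) ring_scheme \<Rightarrow> 'g set \<Rightarrow> ('g \<Rightarrow> 'b set) \<Rightarrow> bool" where
  "internal_direct_sum M I D \<longleftrightarrow>
     (\<forall>g\<in>I. subgroup (D g) (add_monoid M)) \<and>
     (\<forall>x\<in>carrier M. \<exists>!f. f \<in> (\<Pi>\<^sub>E g\<in>I. D g) \<and>
        finite {g \<in> I. f g \<noteq> \<zero>\<^bsub>M\<^esub>} \<and>
        x = (\<Oplus>\<^bsub>M\<^esub>g\<in>{g \<in> I. f g \<noteq> \<zero>\<^bsub>M\<^esub>}. f g))"

locale graded_ring = G: comm_group G + R?: cring R
  for G :: "('g, 'k) monoid_scheme" and R :: "('a, 'm) ring_scheme" (structure) +
  fixes Rd :: "'g \<Rightarrow> 'a set"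
  assumes ring_direct_sum: "internal_direct_sum R (carrier G) Rd"
    and ring_degree_mult:
      "\<lbrakk>g \<in> carrier G; h \<in> carrier G; a \<in> Rd g; b \<in> Rd h\<rbrakk> \<Longrightarrow> a \<otimes> b \<in> Rd (g \<otimes>\<^bsub>G\<^esub> h)"

locale graded_module = graded_ring G R Rd + module R M
  for G :: "('g, 'k) monoid_scheme" and R :: "('a, 'm) ring_scheme" (structure)
    and Rd :: "'g \<Rightarrow> 'a set" and M :: "('a, 'b, 'n) module_scheme" (structure) +
  fixes Md :: "'g \<Rightarrow> 'b set"
  assumes module_direct_sum: "internal_direct_sum M (carrier G) Md"
    and module_degree_smult:
      "\<lbrakk>g \<in> carrier G; h \<in> carrier G; a \<in> Rd g; x \<in> Md h\<rbrakk> \<Longrightarrow> a \<odot>\<^bsub>M\<^esub> x \<in> Md (g \<otimes>\<^bsub>G\<^esub> h)"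

definition homogeneous_ideal ::
    "('g, 'k) monoid_scheme \<Rightarrow> ('a, 'm) ring_scheme \<Rightarrow> ('g \<Rightarrow> 'a set) \<Rightarrow> 'a set \<Rightarrow> bool" where
  "homogeneous_ideal G R Rd I \<longleftrightarrow>
     ideal I R \<and> I = Idl\<^bsub>R\<^esub> (I \<inter> (\<Union>g\<in>carrier G. Rd g))"


section \<open>Length and modest modules\<close>

text \<open>The length is the supremum of the lengths \<open>n\<close> of strict chains
  \<open>N\<^sub>0 \<subset> \<dots> \<subset> N\<^sub>n\<close> of submodules.\<close>

definition module_length :: "('a, 'm) ring_scheme \<Rightarrow> ('a, 'b, 'n) module_scheme \<Rightarrow> enat" where
  "module_length R M =
     (SUP n \<in> {n. \<exists>N :: nat \<Rightarrow> 'b set.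
        (\<forall>i\<le>n. submodule (N i) R M) \<and> (\<forall>i<n. N i \<subset> N (Suc i))}. enat n)"

locale modest_module = graded_module G R Rd M Md
  for G :: "('g, 'k) monoid_scheme" and R :: "('a, 'm) ring_scheme" (structure)
    and Rd :: "'g \<Rightarrow> 'a set" and M :: "('a, 'b, 'n) module_scheme" (structure)
    and Md :: "'g \<Rightarrow> 'b set" +
  assumes finite_length: "g \<in> carrier G \<Longrightarrow>
     module_length (R\<lparr>carrier := Rd \<one>\<^bsub>G\<^esub>\<rparr>) (M\<lparr>carrier := Md g\<rparr>) < \<infinity>"


section \<open>Finite generation, annihilators, primes over an ideal\<close>

definition finitely_generated_module ::
    "('a, 'm) ring_scheme \<Rightarrow> ('a, 'b, 'n) module_scheme \<Rightarrow> bool" where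
  "finitely_generated_module R M \<longleftrightarrow>
     (\<exists>S \<subseteq> carrier M. finite S \<and> carrier M = \<Inter>{N. submodule N R M \<and> S \<subseteq> N})"

definition annihilator :: "('a, 'm) ring_scheme \<Rightarrow> ('a, 'b, 'n) module_scheme \<Rightarrow> 'a set" where
  "annihilator R M = {a \<in> carrier R. \<forall>x\<in>carrier M. a \<odot>\<^bsub>M\<^esub> x = \<zero>\<^bsub>M\<^esub>}"

definition primes_over :: "('a, 'm) ring_scheme \<Rightarrow> 'a set \<Rightarrow> 'a set set" where
  "primes_over R I = {P. primeideal P R \<and> I \<subseteq> P}"

definition minimal_primes_over :: "('a, 'm) ring_scheme \<Rightarrow> 'a set \<Rightarrow> 'a set set" where
  "minimal_primes_over R I =
     {P \<in> primes_over R I. \<forall>Q \<in> primes_over R I. Q \<subseteq> P \<longrightarrow> Q = P}"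


section \<open>Quotients by ideals\<close>

text \<open>\<open>R / I\<close> as an \<open>R\<close>-module; \<open>a\<close> acts as multiplication by its residue class.\<close>

definition quotient_module ::
    "('a, 'm) ring_scheme \<Rightarrow> 'a set \<Rightarrow> ('a, 'a set) module" where
  "quotient_module R I =
     \<lparr>carrier = carrier (R Quot I), mult = mult (R Quot I), one = \<one>\<^bsub>R Quot I\<^esub>,
      zero = \<zero>\<^bsub>R Quot I\<^esub>, add = add (R Quot I),
      smult = (\<lambda>a X. (I +>\<^bsub>R\<^esub> a) \<otimes>\<^bsub>R Quot I\<^esub> X)\<rparr>"

text \<open>\<open>(R / I)\<^sub>g\<close> is the image of \<open>R\<^sub>g\<close>. This is a grading when \<open>I\<close> is homogeneous.\<close>

definition quotient_grading ::
    "('a, 'm) ring_scheme \<Rightarrow> 'a set \<Rightarrow> ('g \<Rightarrow> 'a set) \<Rightarrow> 'g \<Rightarrow> 'a set set" where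
  "quotient_grading R I Rd g = (\<lambda>a. I +>\<^bsub>R\<^esub> a) ` Rd g"


section \<open>Artinian rings\<close>

text \<open>The zero ring is a \<^locale>\<open>cring\<close>, so it is Artinian here.\<close>

locale artinian_ring = cring +
  assumes descending_chain_condition:
    "\<lbrakk>\<And>n::nat. ideal (C n) R; \<And>n. C (Suc n) \<subseteq> C n\<rbrakk> \<Longrightarrow> \<exists>n. \<forall>m\<ge>n. C m = C n"

end

theory Submission
  imports Defs "HOL-Algebra.Subrings"
begin

text \<open>Call an ideal \<open>I\<close> modest if every \<open>R\<^sub>g / I\<^sub>g\<close> has finite length over \<open>R\<^sub>0\<close>, and let \<open>A\<close> be the
  annihilator of \<open>M\<close>; each condition is compared with modesty of \<open>A\<close>.  Adjoining homogeneous generators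
  of \<open>M\<close> one at a time bounds the length of \<open>M\<^sub>g\<close> by lengths in \<open>R / A\<close>; conversely, \<open>A\<close> is the common
  kernel of the maps \<open>r \<mapsto> r m\<close> for these generators \<open>m\<close>.  If \<open>A\<close> is not modest, a homogeneous ideal
  maximal among those that contain \<open>A\<close> and are not modest is prime, so it contains a minimal prime of \<open>A\<close>,
  which is not modest either.  Torsion-freeness enters through a total order on \<open>G\<close>: it lets primality be
  tested on homogeneous elements, so minimal primes of homogeneous ideals are homogeneous.  Finally,
  \<open>(R / A)\<^sub>0\<close> and the \<open>(R / A)\<^sub>g\<close> are Noetherian over \<open>R\<^sub>0\<close>, so the Artinian property in degree \<open>0\<close>
  already forces finite length in every degree.\<close>

section \<open>Finite length as bounded chains of submodules\<close>

text \<open>Only finiteness of lengths matters, never their values, so crude bounds replace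
  additivity of length. Finiteness is measured between two submodules of one fixed module:
  filtrations are compared inside \<open>M\<close> and inside \<open>R\<close> regarded as a module
  over itself, and quotient modules occur only where the statement names them. This also makes
  modesty of an ideal a condition that does not presuppose a grading on the quotient and that passes
  at once to larger ideals. The obstacle is that the chain conditions at hand concern ideals, of
  \<open>R\<close> or of the degree-zero ring, while lengths concern R_0-submodules of a single
  component, which are in general not ideals of \<open>R\<close>. Maximal submodules of R_g are
  therefore found by passing to an ideal of \<open>R\<close> that remembers the submodule, and
  minimal ones in degree zero by passing to the quotient ring. The degenerate case M = 0 needs no
  separate treatment: then the annihilator is the whole ring, there are no primes over it, and the
  unit ideal is modest.\<close>

definition bounded_chains :: "'b set set \<Rightarrow> bool" where
  "bounded_chains L \<longleftrightarrow> (\<exists>b. \<forall>C. finite C \<and> subset.chain L C \<longrightarrow> card C \<le> b)"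

text \<open>On a chain, the pair (F X, H X) determines X, and both images are again chains by
  monotonicity; hence the bound \<open>b1 * b2\<close>. Injectivity is asked for comparable sets
  only, because that is all the modular law provides when F and H are intersection and sum with a
  fixed submodule.\<close>

lemma bounded_chains_prod:
  assumes F: "\<And>X. X \<in> L \<Longrightarrow> F X \<in> L1" and H: "\<And>X. X \<in> L \<Longrightarrow> H X \<in> L2"
    and Fm: "\<And>X Y. \<lbrakk>X \<in> L; Y \<in> L; X \<subseteq> Y\<rbrakk> \<Longrightarrow> F X \<subseteq> F Y"
    and Hm: "\<And>X Y. \<lbrakk>X \<in> L; Y \<in> L; X \<subseteq> Y\<rbrakk> \<Longrightarrow> H X \<subseteq> H Y"
    and inj: "\<And>X Y. \<lbrakk>X \<in> L; Y \<in> L; X \<subseteq> Y; F X = F Y; H X = H Y\<rbrakk> \<Longrightarrow> Y \<subseteq> X"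
    and "bounded_chains L1" and "bounded_chains L2"
  shows "bounded_chains L"
proof -
  obtain b1 b2
    where b1: "\<And>C. finite C \<Longrightarrow> subset.chain L1 C \<Longrightarrow> card C \<le> b1"
      and b2: "\<And>C. finite C \<Longrightarrow> subset.chain L2 C \<Longrightarrow> card C \<le> b2"
    using assms(6,7) unfolding bounded_chains_def by metis
  have "card C \<le> b1 * b2" if C: "finite C" "subset.chain L C" for C
  proof -
    have CL: "C \<subseteq> L" and lin: "\<And>X Y. X \<in> C \<Longrightarrow> Y \<in> C \<Longrightarrow> X \<subseteq> Y \<or> Y \<subseteq> X"
      using C(2) by (auto simp: subset_chain_def)
    have "inj_on (\<lambda>X. (F X, H X)) C"
      proof (intro inj_onI)
      fix X Y assume XY: "X \<in> C" "Y \<in> C" "(F X, H X) = (F Y, H Y)"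
      then have "X \<in> L" "Y \<in> L" using CL by auto
      then show "X = Y" using lin[OF XY(1,2)] inj[of X Y] inj[of Y X] XY(3) by auto
    qed
    then have "card C \<le> card (F ` C \<times> H ` C)"
      using C(1) by (intro card_inj_on_le[where f = "\<lambda>X. (F X, H X)"]) auto
    also have "\<dots> = card (F ` C) * card (H ` C)" by (rule card_cartesian_product)
    also have "\<dots> \<le> b1 * b2"
    proof (intro mult_le_mono b1 b2)
      show "subset.chain L1 (F ` C)" unfolding subset_chain_def
      proof (intro conjI ballI)
        show "F ` C \<subseteq> L1" using CL F by blast
        fix U V assume "U \<in> F ` C" "V \<in> F ` C"
        then obtain X Y where XY: "X \<in> C" "Y \<in> C" "U = F X" "V = F Y" by blast
        then show "U \<subseteq> V \<or> V \<subseteq> U" using CL lin[of X Y] Fm[of X Y] Fm[of Y X] by blast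
      qed
      show "subset.chain L2 (H ` C)" unfolding subset_chain_def
      proof (intro conjI ballI)
        show "H ` C \<subseteq> L2" using CL H by blast
        fix U V assume "U \<in> H ` C" "V \<in> H ` C"
        then obtain X Y where XY: "X \<in> C" "Y \<in> C" "U = H X" "V = H Y" by blast
        then show "U \<subseteq> V \<or> V \<subseteq> U" using CL lin[of X Y] Hm[of X Y] Hm[of Y X] by blast
      qed
    qed (use C in auto)
    finally show ?thesis .
  qed
  then show ?thesis unfolding bounded_chains_def by blast
qed

lemma bounded_chains_embed:
  assumes "\<And>X. X \<in> L \<Longrightarrow> F X \<in> L1"
    and "\<And>X Y. \<lbrakk>X \<in> L; Y \<in> L; X \<subseteq> Y\<rbrakk> \<Longrightarrow> F X \<subseteq> F Y"
    and "\<And>X Y. \<lbrakk>X \<in> L; Y \<in> L; X \<subseteq> Y; F X = F Y\<rbrakk> \<Longrightarrow> Y \<subseteq> X"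
    and "bounded_chains L1"
  shows "bounded_chains L"
  using assms by (intro bounded_chains_prod[where F = F and H = F and L = L and ?L1.0 = L1 and ?L2.0 = L1])

lemma bounded_chains_subset: "bounded_chains L1 \<Longrightarrow> L \<subseteq> L1 \<Longrightarrow> bounded_chains L"
  by (rule bounded_chains_embed[where F = "\<lambda>X. X"]) auto

lemma bounded_chains_finite: "finite L \<Longrightarrow> bounded_chains L"
  unfolding bounded_chains_def by (auto simp: subset_chain_def intro!: exI[of _ "card L"] card_mono)

text \<open>Turns cardinality of a chain into the indexed form used in \<open>module_length\<close>:
  \<open>Suc n\<close> sets make n strict steps. The induction removes the largest member, which is
  the union of the finite chain.\<close>

lemma finite_chain_enumerate:
  assumes "finite C" and "subset.chain L C" and "card C = Suc n"
  shows "\<exists>N. N ` {..n} = C \<and> (\<forall>i<n. N i \<subset> N (Suc i))"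
  using assms
proof (induction n arbitrary: C)
  case 0
  then obtain X where "C = {X}" by (metis One_nat_def card_1_singletonE)
  then have "(\<lambda>_::nat. X) ` {..0} = C" by simp
  then show ?case by blast
next
  case (Suc n)
  have ne: "C \<noteq> {}" using Suc.prems by auto
  have U: "\<Union>C \<in> C" using Union_in_chain[OF Suc.prems(1) ne Suc.prems(2)] .
  let ?D = "C - {\<Union>C}"
  have "card ?D = Suc n" using card_Diff_singleton[OF U] Suc.prems(3) by linarith
  moreover have "subset.chain L ?D"
    using Suc.prems(2) by (simp add: subset_chain_def subset_iff)
  moreover have "finite ?D" using Suc.prems(1) by simp
  ultimately have "\<exists>N. N ` {..n} = ?D \<and> (\<forall>i<n. N i \<subset> N (Suc i))" by (intro Suc.IH)
  then obtain N where N: "N ` {..n} = ?D" "\<forall>i<n. N i \<subset> N (Suc i)" by (elim exE conjE)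
  let ?N = "N(Suc n := \<Union>C)"
  have "?N ` {..n} = N ` {..n}" by (intro image_cong) auto
  then have img: "?N ` {..n} = ?D" using N(1) by simp
  have "?N ` {..Suc n} = insert (?N (Suc n)) (?N ` {..n})" unfolding atMost_Suc by (rule image_insert)
  then have "?N ` {..Suc n} = C" unfolding img using U by auto
  moreover have "N n \<in> ?D" using N(1) by blast
  then have top: "N n \<subset> \<Union>C" by blast
  have "?N i \<subset> ?N (Suc i)" if "i < Suc n" for i
  proof (cases "i = n")
    case True
    then show ?thesis using top by simp
  next
    case False
    then have "i < n" using that by linarith
    moreover from this have "?N i = N i" "?N (Suc i) = N (Suc i)" by auto
    ultimately show ?thesis using N(2) by metis
  qed
  ultimately show ?case by blast
qed

lemma strict_chain_less:
  fixes N :: "nat \<Rightarrow> 'b set"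
  assumes "\<And>i. i < n \<Longrightarrow> N i \<subset> N (Suc i)" and "i < j" and "j \<le> n"
  shows "N i \<subset> N j"
  using assms(2,3)
proof (induction j)
  case (Suc j)
  then show ?case using assms(1)[of j] by (cases "i = j") auto
qed simp

text \<open>A strict chain of length n has \<open>Suc n\<close> members, so a finite length k bounds
  cardinalities by \<open>Suc k\<close>. Conversely, a bound b on cardinalities is a (generous)
  bound on the length.\<close>

lemma module_length_finite_iff:
  fixes M :: "('a, 'b, 'n) module_scheme"
  shows "module_length R M < \<infinity> \<longleftrightarrow> bounded_chains {N. submodule N R M}"
proof
  let ?S = "{n. \<exists>N :: nat \<Rightarrow> 'b set.
        (\<forall>i\<le>n. submodule (N i) R M) \<and> (\<forall>i<n. N i \<subset> N (Suc i))}"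
  let ?L = "{N. submodule N R M}"
  assume "module_length R M < \<infinity>"
  then obtain k where k: "module_length R M = enat k" by (cases "module_length R M") auto
  have "card C \<le> Suc k" if C: "finite C" "subset.chain ?L C" for C
  proof (cases "card C")
    case (Suc n)
    with finite_chain_enumerate[OF C] obtain N
      where N: "N ` {..n} = C" "\<forall>i<n. N i \<subset> N (Suc i)" by auto
    have "\<forall>i\<le>n. submodule (N i) R M" using N(1) C(2) by (auto simp: subset_chain_def)
    then have "n \<in> ?S" using N(2) by blast
    then have "enat n \<le> module_length R M" unfolding module_length_def by (rule SUP_upper)
    then show ?thesis using k Suc by simp
  qed simp
  then show "bounded_chains ?L" unfolding bounded_chains_def by blast
next
  assume "bounded_chains {N. submodule N R M}"
  then obtain b where b: "\<And>C. finite C \<Longrightarrow> subset.chain {N. submodule N R M} C \<Longrightarrow> card C \<le> b"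
    unfolding bounded_chains_def by blast
  have "module_length R M \<le> enat b" unfolding module_length_def
  proof (rule SUP_least, clarify)
    fix n and N :: "nat \<Rightarrow> 'b set"
    assume N: "\<forall>i\<le>n. submodule (N i) R M" "\<forall>i<n. N i \<subset> N (Suc i)"
    have less: "N i \<subset> N j" if "i < j" "j \<le> n" for i j
      using strict_chain_less[of n N i j] N(2) that by blast
    have "inj_on N {..n}"
      by (intro inj_onI) (metis less atMost_iff linorder_neqE_nat psubset_eq)
    then have "card (N ` {..n}) = Suc n" by (simp add: card_image)
    moreover have "subset.chain {N. submodule N R M} (N ` {..n})"
      unfolding subset_chain_def
    proof (intro conjI ballI)
      show "X \<subseteq> Y \<or> Y \<subseteq> X" if XY: "X \<in> N ` {..n}" "Y \<in> N ` {..n}" for X Y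
      proof -
        obtain i j where "X = N i" "i \<le> n" "Y = N j" "j \<le> n" using XY by auto
        then show ?thesis using less[of i j] less[of j i] by (cases i j rule: linorder_cases) auto
      qed
    qed (use N(1) in auto)
    ultimately have "Suc n \<le> b" using b[of "N ` {..n}"] by simp
    then show "enat n \<le> enat b" by simp
  qed
  then show "module_length R M < \<infinity>" by (metis enat_ord_code(4) order_le_less_trans)
qed

text \<open>All finite subsets of the range of C are chains of at most b sets, so the range is
  finite and has a minimal member C n; every later term lies below it and hence equals it.\<close>

lemma bounded_chains_decseq_stable:
  fixes C :: "nat \<Rightarrow> 'b set"
  assumes "bounded_chains L" and "\<And>n. C n \<in> L" and dec: "\<And>n. C (Suc n) \<subseteq> C n"
  shows "\<exists>n. \<forall>m\<ge>n. C m = C n"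
proof -
  have mono: "C m \<subseteq> C n" if "n \<le> m" for m n
    using that
  proof (induction rule: dec_induct)
    case (step k)
    then show ?case using dec[of k] by blast
  qed simp
  obtain b where b: "\<And>D. finite D \<Longrightarrow> subset.chain L D \<Longrightarrow> card D \<le> b"
    using assms(1) unfolding bounded_chains_def by blast
  have "card D \<le> b" if "finite D" "D \<subseteq> range C" for D
  proof (intro b)
    show "subset.chain L D" unfolding subset_chain_def
    proof (intro conjI ballI)
      show "D \<subseteq> L" using that(2) assms(2) by blast
      show "X \<subseteq> Y \<or> Y \<subseteq> X" if XY: "X \<in> D" "Y \<in> D" for X Y
      proof -
        obtain i j where "X = C i" "Y = C j" using XY \<open>D \<subseteq> range C\<close> by blast
        then show ?thesis using mono nat_le_linear[of i j] by blast
      qed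
    qed
  qed (rule that(1))
  then have fin: "finite (range C)"
    by (metis finite_if_finite_subsets_card_bdd)
  obtain X where X: "X \<in> range C" "\<And>Y. Y \<in> range C \<Longrightarrow> Y \<subseteq> X \<Longrightarrow> Y = X"
    using finite_has_minimal[OF fin] by auto
  then obtain n where n: "X = C n" by blast
  have "C m = C n" if "n \<le> m" for m using X(2)[of "C m"] mono[OF that] n by blast
  then show ?thesis by blast
qed

text \<open>By the correspondence theorem this is finiteness of the length of V / U, expressed
  without forming the quotient. U and V are plain sets, which makes shrinking the interval an
  inclusion of families.\<close>

definition finite_length_between ::
    "('a, 'm) ring_scheme \<Rightarrow> ('a, 'b, 'n) module_scheme \<Rightarrow> 'b set \<Rightarrow> 'b set \<Rightarrow> bool" where
  "finite_length_between R M U V \<longleftrightarrow> bounded_chains {N. submodule N R M \<and> U \<subseteq> N \<and> N \<subseteq> V}"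

lemma finite_length_between_mono:
  "\<lbrakk>finite_length_between R M U V; U \<subseteq> U'; V' \<subseteq> V\<rbrakk> \<Longrightarrow> finite_length_between R M U' V'"
  unfolding finite_length_between_def by (erule bounded_chains_subset) auto

lemma (in abelian_group) add_minus_cancel:
  assumes "x \<in> carrier G" and "y \<in> carrier G"
  shows "(x \<oplus> y) \<ominus> x = y" and "x \<oplus> (y \<ominus> x) = y"
proof -
  have "(x \<oplus> y) \<ominus> x = (y \<oplus> x) \<oplus> \<ominus> x" using assms by (simp add: minus_eq a_comm)
  then show 1: "(x \<oplus> y) \<ominus> x = y" using assms by (simp add: a_assoc r_neg)
  then show "x \<oplus> (y \<ominus> x) = y" using assms by (simp add: minus_eq a_assoc)
qed

context module
begin

lemma submodule_zero_mem: "submodule N R M \<Longrightarrow> \<zero>\<^bsub>M\<^esub> \<in> N"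
  by (simp add: submodule_def subgroup.one_closed[of _ "add_monoid M", simplified])

lemma submodule_Int: "submodule N R M \<Longrightarrow> submodule K R M \<Longrightarrow> submodule (N \<inter> K) R M"
proof (rule submoduleI)
  assume N: "submodule N R M" and K: "submodule K R M"
  show "N \<inter> K \<subseteq> carrier M" using submoduleE(1)[OF N] by blast
  show "\<zero>\<^bsub>M\<^esub> \<in> N \<inter> K" using submodule_zero_mem[OF N] submodule_zero_mem[OF K] by blast
  show "\<ominus>\<^bsub>M\<^esub> a \<in> N \<inter> K" if "a \<in> N \<inter> K" for a
    using that submoduleE(3)[OF N] submoduleE(3)[OF K] by blast
  show "a \<oplus>\<^bsub>M\<^esub> b \<in> N \<inter> K" if "a \<in> N \<inter> K" "b \<in> N \<inter> K" for a b
    using that submoduleE(5)[OF N] submoduleE(5)[OF K] by blast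
  show "a \<odot>\<^bsub>M\<^esub> b \<in> N \<inter> K" if "a \<in> carrier R" "b \<in> N \<inter> K" for a b
    using that submoduleE(4)[OF N] submoduleE(4)[OF K] by blast
qed

lemma submodule_diff_mem:
  "\<lbrakk>submodule N R M; x \<in> N; y \<in> N\<rbrakk> \<Longrightarrow> x \<ominus>\<^bsub>M\<^esub> y \<in> N"
  by (simp add: M.minus_eq submoduleE)

lemma submodule_zero: "submodule {\<zero>\<^bsub>M\<^esub>} R M"
  by (rule submoduleI) auto

lemma submodule_sum:
  assumes N: "submodule N R M" and K: "submodule K R M"
  shows "submodule {x \<oplus>\<^bsub>M\<^esub> y | x y. x \<in> N \<and> y \<in> K} R M"
proof (rule submoduleI)
  note [simp] = submoduleE(1)[OF N, THEN subsetD] submoduleE(1)[OF K, THEN subsetD]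
  note [intro] = submoduleE(3-5)[OF N] submoduleE(3-5)[OF K]
  show "{x \<oplus>\<^bsub>M\<^esub> y | x y. x \<in> N \<and> y \<in> K} \<subseteq> carrier M" by auto
  show "\<zero>\<^bsub>M\<^esub> \<in> {x \<oplus>\<^bsub>M\<^esub> y | x y. x \<in> N \<and> y \<in> K}"
    using submodule_zero_mem[OF N] submodule_zero_mem[OF K] by force
  show "\<ominus>\<^bsub>M\<^esub> a \<in> {x \<oplus>\<^bsub>M\<^esub> y | x y. x \<in> N \<and> y \<in> K}"
    if a: "a \<in> {x \<oplus>\<^bsub>M\<^esub> y | x y. x \<in> N \<and> y \<in> K}" for a
  proof -
    obtain x y where xy: "a = x \<oplus>\<^bsub>M\<^esub> y" "x \<in> N" "y \<in> K" using a by blast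
    then have "\<ominus>\<^bsub>M\<^esub> a = \<ominus>\<^bsub>M\<^esub> x \<oplus>\<^bsub>M\<^esub> \<ominus>\<^bsub>M\<^esub> y" by (simp add: M.minus_add)
    then show ?thesis using xy by blast
  qed
  show "a \<oplus>\<^bsub>M\<^esub> b \<in> {x \<oplus>\<^bsub>M\<^esub> y | x y. x \<in> N \<and> y \<in> K}"
    if ab: "a \<in> {x \<oplus>\<^bsub>M\<^esub> y | x y. x \<in> N \<and> y \<in> K}" "b \<in> {x \<oplus>\<^bsub>M\<^esub> y | x y. x \<in> N \<and> y \<in> K}" for a b
  proof -
    obtain x y where xy: "a = x \<oplus>\<^bsub>M\<^esub> y" "x \<in> N" "y \<in> K" using ab by blast
    obtain x' y' where xy': "b = x' \<oplus>\<^bsub>M\<^esub> y'" "x' \<in> N" "y' \<in> K" using ab by blast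
    have "a \<oplus>\<^bsub>M\<^esub> b = (x \<oplus>\<^bsub>M\<^esub> x') \<oplus>\<^bsub>M\<^esub> (y \<oplus>\<^bsub>M\<^esub> y')"
      using xy xy' by (simp add: M.a_ac)
    then show ?thesis using xy xy' by blast
  qed
  show "a \<odot>\<^bsub>M\<^esub> b \<in> {x \<oplus>\<^bsub>M\<^esub> y | x y. x \<in> N \<and> y \<in> K}"
    if ab: "a \<in> carrier R" "b \<in> {x \<oplus>\<^bsub>M\<^esub> y | x y. x \<in> N \<and> y \<in> K}" for a b
  proof -
    obtain x y where xy: "b = x \<oplus>\<^bsub>M\<^esub> y" "x \<in> N" "y \<in> K" using ab by blast
    then have "a \<odot>\<^bsub>M\<^esub> b = a \<odot>\<^bsub>M\<^esub> x \<oplus>\<^bsub>M\<^esub> a \<odot>\<^bsub>M\<^esub> y" using ab(1) by (simp add: smult_r_distr)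
    then show ?thesis using xy ab by blast
  qed
qed

text \<open>A chain between U and V is sent to its intersections with K and its sums with K, that
  is, to chains in K / U and in V / K. By the modular law these two together separate comparable
  submodules.\<close>

lemma finite_length_between_trans:
  assumes K: "submodule K R M" and V: "submodule V R M" and "U \<subseteq> K" and "K \<subseteq> V"
    and "finite_length_between R M U K" and "finite_length_between R M K V"
  shows "finite_length_between R M U V"
  unfolding finite_length_between_def
proof (rule bounded_chains_prod[where F = "\<lambda>N. N \<inter> K" and H = "\<lambda>N. {x \<oplus>\<^bsub>M\<^esub> y | x y. x \<in> N \<and> y \<in> K}"])
  show "bounded_chains {N. submodule N R M \<and> U \<subseteq> N \<and> N \<subseteq> K}"
    "bounded_chains {N. submodule N R M \<and> K \<subseteq> N \<and> N \<subseteq> V}"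
    using assms by (auto simp: finite_length_between_def)
next
  fix X assume X: "X \<in> {N. submodule N R M \<and> U \<subseteq> N \<and> N \<subseteq> V}"
  then have sub: "submodule X R M" by simp
  show "X \<inter> K \<in> {N. submodule N R M \<and> U \<subseteq> N \<and> N \<subseteq> K}"
    using X assms submodule_Int by auto
  have "y \<in> {x \<oplus>\<^bsub>M\<^esub> y | x y. x \<in> X \<and> y \<in> K}" if "y \<in> K" for y
  proof -
    have "y = \<zero>\<^bsub>M\<^esub> \<oplus>\<^bsub>M\<^esub> y" using that submoduleE(1)[OF K] by auto
    then show ?thesis using that submodule_zero_mem[OF sub] by blast
  qed
  moreover have "{x \<oplus>\<^bsub>M\<^esub> y | x y. x \<in> X \<and> y \<in> K} \<subseteq> V"
    using X assms(4) submoduleE(5)[OF V] by blast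
  ultimately show "{x \<oplus>\<^bsub>M\<^esub> y | x y. x \<in> X \<and> y \<in> K} \<in> {N. submodule N R M \<and> K \<subseteq> N \<and> N \<subseteq> V}"
    using submodule_sum[OF sub K] by blast
next
  fix X Y
  assume X: "X \<in> {N. submodule N R M \<and> U \<subseteq> N \<and> N \<subseteq> V}"
    and Y: "Y \<in> {N. submodule N R M \<and> U \<subseteq> N \<and> N \<subseteq> V}"
    and XY: "X \<subseteq> Y" "X \<inter> K = Y \<inter> K"
      "{x \<oplus>\<^bsub>M\<^esub> y | x y. x \<in> X \<and> y \<in> K} = {x \<oplus>\<^bsub>M\<^esub> y | x y. x \<in> Y \<and> y \<in> K}"
  show "Y \<subseteq> X"
  proof
    fix y assume y: "y \<in> Y"
    have sX: "submodule X R M" and sY: "submodule Y R M" using X Y by auto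
    have yc: "y \<in> carrier M" using submoduleE(1)[OF sY] y by blast
    have "y = y \<oplus>\<^bsub>M\<^esub> \<zero>\<^bsub>M\<^esub>" using yc by simp
    then have "y \<in> {x \<oplus>\<^bsub>M\<^esub> y | x y. x \<in> Y \<and> y \<in> K}"
      using y submodule_zero_mem[OF K] by blast
    \<comment> \<open>The modular law: \<open>k = y - x\<close> lies in
      \<open>Y \<inter> K = X \<inter> K\<close>, so \<open>y = x + k\<close> lies in
      \<open>X\<close>.\<close>
    then obtain x k where xk: "y = x \<oplus>\<^bsub>M\<^esub> k" "x \<in> X" "k \<in> K" using XY(3) by blast
    have c: "x \<in> carrier M" "k \<in> carrier M" using xk submoduleE(1)[OF sX] submoduleE(1)[OF K] by auto
    have "k = y \<ominus>\<^bsub>M\<^esub> x" using xk(1) c M.add_minus_cancel(1) by simp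
    then have "k \<in> Y" using submodule_diff_mem[OF sY y] xk(2) XY(1) by auto
    then show "y \<in> X" using xk XY(2) submoduleE(5)[OF sX] by blast
  qed
qed blast+

end

section \<open>Linear maps and the transfer of finite length along them\<close>

locale module_map = X: module R X + Y: module R Y
  for R :: "('a, 'm) ring_scheme" and X :: "('a, 'b, 'n) module_scheme"
    and Y :: "('a, 'c, 'o) module_scheme" +
  fixes f :: "'b \<Rightarrow> 'c"
  assumes map_closed: "x \<in> carrier X \<Longrightarrow> f x \<in> carrier Y"
    and map_add: "\<lbrakk>x \<in> carrier X; y \<in> carrier X\<rbrakk> \<Longrightarrow> f (x \<oplus>\<^bsub>X\<^esub> y) = f x \<oplus>\<^bsub>Y\<^esub> f y"
    and map_smult: "\<lbrakk>a \<in> carrier R; x \<in> carrier X\<rbrakk> \<Longrightarrow> f (a \<odot>\<^bsub>X\<^esub> x) = a \<odot>\<^bsub>Y\<^esub> f x"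
begin

lemma map_zero: "f \<zero>\<^bsub>X\<^esub> = \<zero>\<^bsub>Y\<^esub>"
  using map_smult[of "\<zero>\<^bsub>R\<^esub>" "\<zero>\<^bsub>X\<^esub>"] map_closed by simp

lemma map_uminus: "x \<in> carrier X \<Longrightarrow> f (\<ominus>\<^bsub>X\<^esub> x) = \<ominus>\<^bsub>Y\<^esub> f x"
  by (metis X.M.a_inv_closed X.M.l_neg Y.M.minus_equality map_add map_closed map_zero)

lemma map_minus: "\<lbrakk>x \<in> carrier X; y \<in> carrier X\<rbrakk> \<Longrightarrow> f (x \<ominus>\<^bsub>X\<^esub> y) = f x \<ominus>\<^bsub>Y\<^esub> f y"
  by (simp add: X.M.minus_eq Y.M.minus_eq map_add map_uminus)

lemma submodule_image:
  assumes N: "submodule N R X"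
  shows "submodule (f ` N) R Y"
proof (rule Y.submoduleI)
  note c = X.submoduleE(1)[OF N, THEN subsetD]
  show "f ` N \<subseteq> carrier Y" using c map_closed by auto
  show "\<zero>\<^bsub>Y\<^esub> \<in> f ` N" using X.submodule_zero_mem[OF N] map_zero by (metis imageI)
  show "\<ominus>\<^bsub>Y\<^esub> a \<in> f ` N" if "a \<in> f ` N" for a
    using that c X.submoduleE(3)[OF N] by (auto simp flip: map_uminus)
  show "a \<oplus>\<^bsub>Y\<^esub> b \<in> f ` N" if "a \<in> f ` N" "b \<in> f ` N" for a b
    using that c X.submoduleE(5)[OF N] by (auto simp flip: map_add)
  show "a \<odot>\<^bsub>Y\<^esub> x \<in> f ` N" if "a \<in> carrier R" "x \<in> f ` N" for a x
    using that c X.submoduleE(4)[OF N] by (auto simp flip: map_smult)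
qed

lemma submodule_vimage:
  assumes N: "submodule N R Y" and V: "submodule V R X"
  shows "submodule {x \<in> V. f x \<in> N} R X"
  by (rule X.submoduleI)
    (use X.submoduleE[OF V] Y.submoduleE[OF N] X.submodule_zero_mem[OF V] Y.submodule_zero_mem[OF N]
      in \<open>auto simp: map_zero map_uminus map_add map_smult subset_iff\<close>)

text \<open>The hypotheses say that f maps V / U to a module that covers V' / U'. A submodule N
  between U' and V' is recovered from its preimage in V: writing y = u + f v with u in U', which is
  contained in N, the element y lies in N exactly when f v does.\<close>

lemma finite_length_between_map:
  assumes "finite_length_between R X U V" and V: "submodule V R X" and "U \<subseteq> V" and U': "f ` U \<subseteq> U'"
    and V': "\<And>y. y \<in> V' \<Longrightarrow> \<exists>u\<in>U'. \<exists>v\<in>V. y = u \<oplus>\<^bsub>Y\<^esub> f v"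
  shows "finite_length_between R Y U' V'"
  unfolding finite_length_between_def
proof (rule bounded_chains_embed[where F = "\<lambda>N. {x \<in> V. f x \<in> N}"])
  show "bounded_chains {N. submodule N R X \<and> U \<subseteq> N \<and> N \<subseteq> V}"
    using assms(1) by (simp add: finite_length_between_def)
  show "{x \<in> V. f x \<in> N} \<in> {N. submodule N R X \<and> U \<subseteq> N \<and> N \<subseteq> V}"
    if "N \<in> {N. submodule N R Y \<and> U' \<subseteq> N \<and> N \<subseteq> V'}" for N
    using that submodule_vimage[OF _ V] U' assms(3) by auto
  fix N K
  assume N: "N \<in> {N. submodule N R Y \<and> U' \<subseteq> N \<and> N \<subseteq> V'}"
    and K: "K \<in> {N. submodule N R Y \<and> U' \<subseteq> N \<and> N \<subseteq> V'}"
    and NK: "N \<subseteq> K" "{x \<in> V. f x \<in> N} = {x \<in> V. f x \<in> K}"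
  show "K \<subseteq> N"
  proof
    fix y assume y: "y \<in> K"
    then obtain u v where uv: "u \<in> U'" "v \<in> V" "y = u \<oplus>\<^bsub>Y\<^esub> f v" using V' K by blast
    have sK: "submodule K R Y" and sN: "submodule N R Y" using N K by auto
    have c: "u \<in> carrier Y" "f v \<in> carrier Y"
      using uv N Y.submoduleE(1)[OF sN] X.submoduleE(1)[OF V] map_closed by auto
    have "f v = y \<ominus>\<^bsub>Y\<^esub> u" using uv c Y.M.add_minus_cancel(1) by simp
    then have "f v \<in> K" using Y.submodule_diff_mem[OF sK y, of u] uv K by auto
    then have "f v \<in> N" using NK uv by blast
    then show "y \<in> N" using uv N Y.submoduleE(5)[OF sN] by auto
  qed
qed auto

text \<open>Dual to the previous transfer: a submodule of V containing the kernel of f on V is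
  recovered from its image, since f y = f x puts y - x into that kernel. So V / U is controlled by
  the image of V inside W.\<close>

lemma finite_length_between_ker:
  assumes "finite_length_between R Y {\<zero>\<^bsub>Y\<^esub>} W" and V: "submodule V R X" and W: "f ` V \<subseteq> W"
    and U: "\<And>x. \<lbrakk>x \<in> V; f x = \<zero>\<^bsub>Y\<^esub>\<rbrakk> \<Longrightarrow> x \<in> U"
  shows "finite_length_between R X U V"
  unfolding finite_length_between_def
proof (rule bounded_chains_embed[where F = "\<lambda>N. f ` N"])
  show "bounded_chains {N. submodule N R Y \<and> {\<zero>\<^bsub>Y\<^esub>} \<subseteq> N \<and> N \<subseteq> W}"
    using assms(1) by (simp add: finite_length_between_def)
  show "f ` N \<in> {N. submodule N R Y \<and> {\<zero>\<^bsub>Y\<^esub>} \<subseteq> N \<and> N \<subseteq> W}"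
    if "N \<in> {N. submodule N R X \<and> U \<subseteq> N \<and> N \<subseteq> V}" for N
    using that submodule_image[of N] W Y.submodule_zero_mem by blast
  fix N K
  assume N: "N \<in> {N. submodule N R X \<and> U \<subseteq> N \<and> N \<subseteq> V}"
    and K: "K \<in> {N. submodule N R X \<and> U \<subseteq> N \<and> N \<subseteq> V}"
    and NK: "N \<subseteq> K" "f ` N = f ` K"
  show "K \<subseteq> N"
  proof
    fix y assume y: "y \<in> K"
    then obtain x where x: "x \<in> N" "f y = f x" using NK(2) by (metis image_iff)
    have sK: "submodule K R X" and sN: "submodule N R X" using N K by auto
    have c: "x \<in> carrier X" "y \<in> carrier X"
      using x y X.submoduleE(1)[OF sN] X.submoduleE(1)[OF sK] by auto
    have "f (y \<ominus>\<^bsub>X\<^esub> x) = \<zero>\<^bsub>Y\<^esub>" using c x map_closed by (simp add: map_minus Y.M.r_neg Y.M.minus_eq)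
    moreover have "y \<ominus>\<^bsub>X\<^esub> x \<in> V" using X.submodule_diff_mem[OF sK y, of x] x NK K by auto
    ultimately have "y \<ominus>\<^bsub>X\<^esub> x \<in> N" using U N by blast
    then have "x \<oplus>\<^bsub>X\<^esub> (y \<ominus>\<^bsub>X\<^esub> x) \<in> N" using x X.submoduleE(5)[OF sN] by blast
    moreover have "x \<oplus>\<^bsub>X\<^esub> (y \<ominus>\<^bsub>X\<^esub> x) = y"
      using c by (rule X.M.add_minus_cancel(2))
    ultimately show "y \<in> N" by simp
  qed
qed auto

end

text \<open>\<open>modest_module\<close> measures the module whose carrier is shrunk to one
  component. This turns its submodules into submodules of the ambient module, so that all components
  can be handled in one place.\<close>

lemma submodule_carrier_update:
  fixes M :: "('a, 'b, 'n) module_scheme"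
  assumes "abelian_group M" and "subgroup D (add_monoid M)"
  shows "submodule N R (M\<lparr>carrier := D\<rparr>) \<longleftrightarrow> submodule N R M \<and> N \<subseteq> D"
proof -
  interpret M: abelian_group M by fact
  have eq: "add_monoid (M\<lparr>carrier := D\<rparr>) = (add_monoid M)\<lparr>carrier := D\<rparr>" by simp
  have "subgroup N ((add_monoid M)\<lparr>carrier := D\<rparr>) \<longleftrightarrow> subgroup N (add_monoid M) \<and> N \<subseteq> D"
    using M.add.incl_subgroup[OF assms(2), of N] M.add.subgroup_incl[OF _ assms(2), of N]
      subgroup.subset[of N "(add_monoid M)\<lparr>carrier := D\<rparr>"] by auto
  then show ?thesis unfolding submodule_def submodule_axioms_def eq by auto
qed

section \<open>Homogeneous components\<close>

locale direct_sum = abelian_group M for M (structure) +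
  fixes I :: "'i set" and D :: "'i \<Rightarrow> 'a set"
  assumes direct_sum: "internal_direct_sum M I D"
begin

lemma summand_subgroup: "g \<in> I \<Longrightarrow> subgroup (D g) (add_monoid M)"
  using direct_sum by (simp add: internal_direct_sum_def)

lemma summand_carrier: "g \<in> I \<Longrightarrow> x \<in> D g \<Longrightarrow> x \<in> carrier M"
  using subgroup.mem_carrier[OF summand_subgroup] by simp

lemma summand_zero: "g \<in> I \<Longrightarrow> \<zero> \<in> D g"
  using subgroup.one_closed[OF summand_subgroup] by simp

lemma summand_add: "g \<in> I \<Longrightarrow> x \<in> D g \<Longrightarrow> y \<in> D g \<Longrightarrow> x \<oplus> y \<in> D g"
  using subgroup.m_closed[OF summand_subgroup] by simp

lemma summand_uminus: "g \<in> I \<Longrightarrow> x \<in> D g \<Longrightarrow> \<ominus> x \<in> D g"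
  using subgroup.m_inv_closed[OF summand_subgroup] by (simp add: a_inv_def)

definition hcomp :: "'a \<Rightarrow> 'i \<Rightarrow> 'a" where
  "hcomp x = (THE f. f \<in> (\<Pi>\<^sub>E g\<in>I. D g) \<and> finite {g \<in> I. f g \<noteq> \<zero>} \<and>
     x = (\<Oplus>g\<in>{g \<in> I. f g \<noteq> \<zero>}. f g))"

lemma hcomp_props:
  assumes "x \<in> carrier M"
  shows "hcomp x \<in> (\<Pi>\<^sub>E g\<in>I. D g)" and "finite {g \<in> I. hcomp x g \<noteq> \<zero>}"
    and "x = (\<Oplus>g\<in>{g \<in> I. hcomp x g \<noteq> \<zero>}. hcomp x g)"
proof -
  have "\<exists>!f. f \<in> (\<Pi>\<^sub>E g\<in>I. D g) \<and> finite {g \<in> I. f g \<noteq> \<zero>} \<and>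
     x = (\<Oplus>g\<in>{g \<in> I. f g \<noteq> \<zero>}. f g)"
    using direct_sum assms by (simp add: internal_direct_sum_def)
  from theI'[OF this] show "hcomp x \<in> (\<Pi>\<^sub>E g\<in>I. D g)" and "finite {g \<in> I. hcomp x g \<noteq> \<zero>}"
    and "x = (\<Oplus>g\<in>{g \<in> I. hcomp x g \<noteq> \<zero>}. hcomp x g)"
    unfolding hcomp_def by blast+
qed

lemma hcomp_mem: "x \<in> carrier M \<Longrightarrow> g \<in> I \<Longrightarrow> hcomp x g \<in> D g"
  using hcomp_props(1) by (meson PiE_mem)

lemma hcomp_closed: "x \<in> carrier M \<Longrightarrow> g \<in> I \<Longrightarrow> hcomp x g \<in> carrier M"
  using hcomp_mem summand_carrier by blast

text \<open>By uniqueness of the decomposition, any finite sum with one term per degree already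
  displays its components. The computation rules for \<open>hcomp\<close> below rest on
  this.\<close>

lemma hcomp_finsum:
  assumes F: "finite F" "F \<subseteq> I" and f: "\<And>g. g \<in> F \<Longrightarrow> f g \<in> D g" and g: "g \<in> I"
  shows "hcomp (\<Oplus>h\<in>F. f h) g = (if g \<in> F then f g else \<zero>)"
proof -
  \<comment> \<open>The decomposition demands a function on all of \<open>I\<close>, undefined
    outside, whose support excludes zero terms; f is therefore extended by zero, and terms of f that
    vanish drop out of the sum.\<close>
  define f' where "f' = restrict (\<lambda>g. if g \<in> F then f g else \<zero>) I"
  have fc: "f h \<in> carrier M" if "h \<in> F" for h using f[OF that] summand_carrier that F(2) by blast
  have supp: "{g \<in> I. f' g \<noteq> \<zero>} = {g \<in> F. f g \<noteq> \<zero>}" using F(2) by (auto simp: f'_def)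
  have 1: "f' \<in> (\<Pi>\<^sub>E g\<in>I. D g)" using f summand_zero by (auto simp: f'_def)
  have 2: "finite {g \<in> I. f' g \<noteq> \<zero>}" unfolding supp using F(1) by simp
  have "(\<Oplus>g\<in>{g \<in> F. f g \<noteq> \<zero>}. f' g) = (\<Oplus>h\<in>F. f h)"
    using F fc by (intro add.finprod_mono_neutral_cong_left) (auto simp: f'_def)
  then have 3: "(\<Oplus>h\<in>F. f h) = (\<Oplus>g\<in>{g \<in> I. f' g \<noteq> \<zero>}. f' g)" unfolding supp by simp
  have "(\<Oplus>h\<in>F. f h) \<in> carrier M" using fc by (intro finsum_closed) auto
  have "hcomp (\<Oplus>h\<in>F. f h) = f'"
    unfolding hcomp_def
  proof (rule the1_equality)
    show "\<exists>!fa. fa \<in> (\<Pi>\<^sub>E g\<in>I. D g) \<and> finite {g \<in> I. fa g \<noteq> \<zero>} \<and>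
      (\<Oplus>h\<in>F. f h) = (\<Oplus>g\<in>{g \<in> I. fa g \<noteq> \<zero>}. fa g)"
      using direct_sum \<open>(\<Oplus>h\<in>F. f h) \<in> carrier M\<close> by (simp add: internal_direct_sum_def)
  qed (use 1 2 3 in blast)
  then show ?thesis using g by (simp add: f'_def)
qed

definition supp :: "'a \<Rightarrow> 'i set" where "supp x = {g \<in> I. hcomp x g \<noteq> \<zero>}"

lemma supp_subset: "supp x \<subseteq> I"
  by (auto simp: supp_def)

lemma finite_supp: "x \<in> carrier M \<Longrightarrow> finite (supp x)"
  using hcomp_props(2) by (simp add: supp_def)

lemma hcomp_sum:
  assumes "x \<in> carrier M" and "finite F" and "supp x \<subseteq> F" and "F \<subseteq> I"
  shows "(\<Oplus>g\<in>F. hcomp x g) = x"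
proof -
  have "(\<Oplus>g\<in>supp x. hcomp x g) = (\<Oplus>g\<in>F. hcomp x g)"
    using assms hcomp_closed[OF assms(1)]
    by (intro add.finprod_mono_neutral_cong_left) (auto simp: supp_def)
  then show ?thesis using hcomp_props(3)[OF assms(1)] by (simp add: supp_def)
qed

lemma hcomp_homogeneous:
  assumes "h \<in> I" and "x \<in> D h" and "g \<in> I"
  shows "hcomp x g = (if g = h then x else \<zero>)"
  using hcomp_finsum[of "{h}" "\<lambda>_. x" g] assms summand_carrier[OF assms(1,2)] by simp

lemma hcomp_add:
  assumes x: "x \<in> carrier M" and y: "y \<in> carrier M" and g: "g \<in> I"
  shows "hcomp (x \<oplus> y) g = hcomp x g \<oplus> hcomp y g"
proof -
  define F where "F = supp x \<union> supp y \<union> {g}"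
  have F: "finite F" "F \<subseteq> I" "supp x \<subseteq> F" "supp y \<subseteq> F" "g \<in> F"
    using finite_supp x y supp_subset g by (auto simp: F_def)
  have "x \<oplus> y = (\<Oplus>g\<in>F. hcomp x g) \<oplus> (\<Oplus>g\<in>F. hcomp y g)"
    using hcomp_sum F x y by simp
  also have "\<dots> = (\<Oplus>g\<in>F. hcomp x g \<oplus> hcomp y g)"
    using F(2) hcomp_closed x y by (intro finsum_addf[symmetric]) auto
  finally have "hcomp (x \<oplus> y) g = hcomp (\<Oplus>g\<in>F. hcomp x g \<oplus> hcomp y g) g" by simp
  also have "\<dots> = hcomp x g \<oplus> hcomp y g"
    using hcomp_finsum[of F "\<lambda>g. hcomp x g \<oplus> hcomp y g" g] F g x y
    by (simp add: hcomp_mem summand_add subset_iff)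
  finally show ?thesis .
qed

lemma hcomp_zero: "g \<in> I \<Longrightarrow> hcomp \<zero> g = \<zero>"
  using hcomp_finsum[of "{}" "\<lambda>_. \<zero>" g] by simp

lemma hcomp_uminus:
  assumes "x \<in> carrier M" and "g \<in> I"
  shows "hcomp (\<ominus> x) g = \<ominus> hcomp x g"
proof -
  have "hcomp (\<ominus> x) g \<oplus> hcomp x g = \<zero>"
    using hcomp_add[of "\<ominus> x" x g] assms by (simp add: l_neg hcomp_zero)
  then show ?thesis using assms hcomp_closed by (intro minus_equality[symmetric]) auto
qed

lemma hcomp_distrib_finsum:
  assumes "finite A" and "f \<in> A \<rightarrow> carrier M" and "g \<in> I"
  shows "hcomp (\<Oplus>i\<in>A. f i) g = (\<Oplus>i\<in>A. hcomp (f i) g)"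
  using assms(1,2)
proof (induction A rule: finite_induct)
  case (insert a A)
  then have "f a \<in> carrier M" "f \<in> A \<rightarrow> carrier M" by auto
  moreover from this have "(\<lambda>i. hcomp (f i) g) \<in> A \<rightarrow> carrier M" "hcomp (f a) g \<in> carrier M"
    using hcomp_closed assms(3) by auto
  ultimately show ?case using insert assms(3) by (simp add: hcomp_add)
qed (simp add: hcomp_zero assms(3))

text \<open>An element is the sum of its finitely many components, so an additive property only has
  to be checked in a single degree. The proof is a finite induction over partial sums of
  components.\<close>

lemma homogeneous_induct [consumes 1, case_names homogeneous zero add]:
  assumes "x \<in> carrier M"
    and h: "\<And>g x. \<lbrakk>g \<in> I; x \<in> D g\<rbrakk> \<Longrightarrow> P x" and z: "P \<zero>"
    and a: "\<And>x y. \<lbrakk>x \<in> carrier M; y \<in> carrier M; P x; P y\<rbrakk> \<Longrightarrow> P (x \<oplus> y)"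
  shows "P x"
proof -
  have "P (\<Oplus>g\<in>F. hcomp x g)" if "finite F" "F \<subseteq> I" for F
    using that
  proof (induction F rule: finite_induct)
    case empty
    show ?case using z by simp
  next
    case (insert g F)
    have c: "hcomp x g \<in> carrier M" "hcomp x \<in> F \<rightarrow> carrier M"
      using insert.prems hcomp_closed[OF assms(1)] by auto
    have "P (hcomp x g \<oplus> (\<Oplus>g\<in>F. hcomp x g))"
      using insert c h[of g "hcomp x g"] hcomp_mem[OF assms(1), of g] by (intro a) auto
    then show ?case using insert c by simp
  qed
  from this[OF finite_supp[OF assms(1)] supp_subset] show ?thesis
    using hcomp_sum[OF assms(1) finite_supp[OF assms(1)] subset_refl supp_subset] by simp
qed

end

text \<open>Additive maps p g that fix D g and kill the other summands force uniqueness: applied to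
  any decomposition, p g returns its g-term. Needed for quotients, where such projections are
  induced by taking components of a representative.\<close>

lemma internal_direct_sumI:
  fixes M (structure)
  assumes "abelian_group M"
    and D: "\<And>g. g \<in> I \<Longrightarrow> subgroup (D g) (add_monoid M)"
    and span: "\<And>x. x \<in> carrier M \<Longrightarrow>
      \<exists>F f. finite F \<and> F \<subseteq> I \<and> (\<forall>g\<in>F. f g \<in> D g) \<and> x = (\<Oplus>g\<in>F. f g)"
    and proj_closed: "\<And>g x. \<lbrakk>g \<in> I; x \<in> carrier M\<rbrakk> \<Longrightarrow> p g x \<in> carrier M"
    and proj_add: "\<And>g x y. \<lbrakk>g \<in> I; x \<in> carrier M; y \<in> carrier M\<rbrakk> \<Longrightarrow> p g (x \<oplus> y) = p g x \<oplus> p g y"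
    and proj: "\<And>g h x. \<lbrakk>g \<in> I; h \<in> I; x \<in> D h\<rbrakk> \<Longrightarrow> p g x = (if g = h then x else \<zero>)"
  shows "internal_direct_sum M I D"
  unfolding internal_direct_sum_def
proof (intro conjI ballI D)
  interpret abelian_group M by fact
  have Dc: "x \<in> carrier M" if "g \<in> I" "x \<in> D g" for g x
    using subgroup.mem_carrier[OF D] that by auto
  have D0: "\<zero> \<in> D g" if "g \<in> I" for g
    using subgroup.one_closed[OF D] that by auto
  have psum: "p g (\<Oplus>h\<in>F. f h) = (if g \<in> F then f g else \<zero>)"
    if F: "finite F" "F \<subseteq> I" "\<And>h. h \<in> F \<Longrightarrow> f h \<in> D h" and g: "g \<in> I" for F f g
    using F
  proof (induction F rule: finite_induct)
    case empty
    show ?case using proj[OF g g D0[OF g]] by simp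
  next
    case (insert h F)
    have c: "f h \<in> carrier M" "f \<in> F \<rightarrow> carrier M" using insert.prems Dc by auto
    have "p g (\<Oplus>h\<in>insert h F. f h) = p g (f h) \<oplus> p g (\<Oplus>h\<in>F. f h)"
      using insert c g by (simp add: proj_add)
    also have "\<dots> = (if g = h then f h else \<zero>) \<oplus> (if g \<in> F then f g else \<zero>)"
      using insert proj[OF g, of h "f h"] by simp
    also have "\<dots> = (if g \<in> insert h F then f g else \<zero>)"
      using insert.hyps c Pi_mem[OF c(2), of g] by auto
    finally show ?case .
  qed
  fix x assume x: "x \<in> carrier M"
  obtain F f where F: "finite F" "F \<subseteq> I" "\<And>g. g \<in> F \<Longrightarrow> f g \<in> D g" "x = (\<Oplus>g\<in>F. f g)"
    using span[OF x] by blast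
  define f' where "f' = restrict (\<lambda>g. if g \<in> F then f g else \<zero>) I"
  have fc: "f h \<in> carrier M" if "h \<in> F" for h using F that Dc by blast
  have supp: "{g \<in> I. f' g \<noteq> \<zero>} = {g \<in> F. f g \<noteq> \<zero>}" using F(2) by (auto simp: f'_def)
  have "(\<Oplus>g\<in>{g \<in> F. f g \<noteq> \<zero>}. f' g) = (\<Oplus>h\<in>F. f h)"
    using F(1,2) fc by (intro add.finprod_mono_neutral_cong_left) (auto simp: f'_def)
  then have sum: "x = (\<Oplus>g\<in>{g \<in> I. f' g \<noteq> \<zero>}. f' g)" unfolding supp F(4) by simp
  show "\<exists>!f. f \<in> (\<Pi>\<^sub>E g\<in>I. D g) \<and> finite {g \<in> I. f g \<noteq> \<zero>} \<and>
     x = (\<Oplus>g\<in>{g \<in> I. f g \<noteq> \<zero>}. f g)"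
  proof (rule ex1I[of _ f'], intro conjI sum)
    show "f' \<in> (\<Pi>\<^sub>E g\<in>I. D g)" using F(3) D0 by (auto simp: f'_def)
    show "finite {g \<in> I. f' g \<noteq> \<zero>}" unfolding supp using F(1) by simp
    fix e assume e: "e \<in> (\<Pi>\<^sub>E g\<in>I. D g) \<and> finite {g \<in> I. e g \<noteq> \<zero>} \<and>
     x = (\<Oplus>g\<in>{g \<in> I. e g \<noteq> \<zero>}. e g)"
    have "e g = f' g" for g
    proof (cases "g \<in> I")
      case True
      have "p g (\<Oplus>g\<in>{g \<in> I. e g \<noteq> \<zero>}. e g) = (if g \<in> {g \<in> I. e g \<noteq> \<zero>} then e g else \<zero>)"
        using e by (intro psum True) auto
      then have "p g x = e g" using e True by auto
      moreover have "p g x = (if g \<in> F then f g else \<zero>)"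
        unfolding F(4) using F by (intro psum True) auto
      ultimately show ?thesis using True by (simp add: f'_def)
    next
      case False
      then show ?thesis using e by (auto simp: f'_def PiE_def extensional_def)
    qed
    then show "e = f'" by blast
  qed
qed

section \<open>Homogeneous ideals\<close>

text \<open>The ring as a module over itself. Ideals of \<open>R\<close> and R_0-submodules of R_g
  become submodules of one module, so statements proved for graded modules also serve the
  ring.\<close>

definition regular_module :: "('a, 'm) ring_scheme \<Rightarrow> ('a, 'a) module" where
  "regular_module R = \<lparr>carrier = carrier R, mult = mult R, one = \<one>\<^bsub>R\<^esub>, zero = \<zero>\<^bsub>R\<^esub>,
     add = add R, smult = mult R\<rparr>"

lemma regular_module_simps [simp]:
  "carrier (regular_module R) = carrier R" "zero (regular_module R) = \<zero>\<^bsub>R\<^esub>"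
  "add (regular_module R) = add R" "smult (regular_module R) = mult R"
  by (simp_all add: regular_module_def)

lemma finsum_regular_module [simp]: "finsum (regular_module R) = finsum R"
  by (simp add: finsum_def fun_eq_iff finprod_def)

lemma subgroup_regular_module:
  "subgroup N (add_monoid (regular_module R)) \<longleftrightarrow> subgroup N (add_monoid R)"
  by (simp add: subgroup_def m_inv_def)

lemma (in cring) module_regular_module: "module R (regular_module R)"
proof (rule moduleI)
  show "abelian_group (regular_module R)"
  proof (rule abelian_groupI)
    show "\<exists>y\<in>carrier (regular_module R). y \<oplus>\<^bsub>regular_module R\<^esub> x = \<zero>\<^bsub>regular_module R\<^esub>"
      if "x \<in> carrier (regular_module R)" for x
      using that l_neg[of x] a_inv_closed[of x] by auto
  qed (auto simp: a_ac)
qed (auto simp: is_cring l_distr r_distr m_assoc)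

sublocale graded_ring \<subseteq> RD: direct_sum R "carrier G" Rd
  by unfold_locales (rule ring_direct_sum)

sublocale graded_module \<subseteq> MD: direct_sum M "carrier G" Md
  by unfold_locales (rule module_direct_sum)

context graded_module
begin

text \<open>Multiplication by x shifts all degrees by k. Both sides are additive in r, so r may be
  taken homogeneous, and cancellation in \<open>G\<close> then decides which component
  survives.\<close>

lemma hcomp_smult_right:
  assumes "r \<in> carrier R" and k: "k \<in> carrier G" and x: "x \<in> Md k" and h: "h \<in> carrier G"
  shows "MD.hcomp (r \<odot>\<^bsub>M\<^esub> x) (h \<otimes>\<^bsub>G\<^esub> k) = RD.hcomp r h \<odot>\<^bsub>M\<^esub> x"
  using assms(1)
proof (induction r rule: RD.homogeneous_induct)
  case (homogeneous l r)
  have xc: "x \<in> carrier M" using MD.summand_carrier k x .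
  have "r \<odot>\<^bsub>M\<^esub> x \<in> Md (l \<otimes>\<^bsub>G\<^esub> k)" using module_degree_smult homogeneous k x by blast
  then have "MD.hcomp (r \<odot>\<^bsub>M\<^esub> x) (h \<otimes>\<^bsub>G\<^esub> k) = (if h \<otimes>\<^bsub>G\<^esub> k = l \<otimes>\<^bsub>G\<^esub> k then r \<odot>\<^bsub>M\<^esub> x else \<zero>\<^bsub>M\<^esub>)"
    using homogeneous k h by (intro MD.hcomp_homogeneous) auto
  moreover have "RD.hcomp r h = (if h = l then r else \<zero>)"
    using homogeneous h by (intro RD.hcomp_homogeneous) auto
  ultimately show ?case using homogeneous k h xc by auto
next
  case zero
  show ?case using MD.summand_carrier[OF k x] k h by (simp add: MD.hcomp_zero RD.hcomp_zero)
next
  case (add r s)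
  then show ?case using MD.summand_carrier[OF k x] k h
    by (simp add: smult_l_distr MD.hcomp_add RD.hcomp_add RD.hcomp_closed)
qed

lemma hcomp_smult_left:
  assumes "x \<in> carrier M" and h: "h \<in> carrier G" and r: "r \<in> Rd h" and k: "k \<in> carrier G"
  shows "MD.hcomp (r \<odot>\<^bsub>M\<^esub> x) (h \<otimes>\<^bsub>G\<^esub> k) = r \<odot>\<^bsub>M\<^esub> MD.hcomp x k"
  using assms(1)
proof (induction x rule: MD.homogeneous_induct)
  case (homogeneous l x)
  have rc: "r \<in> carrier R" using RD.summand_carrier h r .
  have "r \<odot>\<^bsub>M\<^esub> x \<in> Md (h \<otimes>\<^bsub>G\<^esub> l)" using module_degree_smult homogeneous h r by blast
  then have "MD.hcomp (r \<odot>\<^bsub>M\<^esub> x) (h \<otimes>\<^bsub>G\<^esub> k) = (if h \<otimes>\<^bsub>G\<^esub> k = h \<otimes>\<^bsub>G\<^esub> l then r \<odot>\<^bsub>M\<^esub> x else \<zero>\<^bsub>M\<^esub>)"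
    using homogeneous k h by (intro MD.hcomp_homogeneous) auto
  moreover have "MD.hcomp x k = (if k = l then x else \<zero>\<^bsub>M\<^esub>)"
    using homogeneous k by (intro MD.hcomp_homogeneous) auto
  ultimately show ?case using homogeneous k h rc by auto
next
  case zero
  show ?case using RD.summand_carrier[OF h r] k h by (simp add: MD.hcomp_zero)
next
  case (add x y)
  then show ?case using RD.summand_carrier[OF h r] k h
    by (simp add: smult_r_distr MD.hcomp_add MD.hcomp_closed)
qed

lemma hcomp_smult_left':
  assumes "x \<in> carrier M" and h: "h \<in> carrier G" and r: "r \<in> Rd h" and g: "g \<in> carrier G"
  shows "MD.hcomp (r \<odot>\<^bsub>M\<^esub> x) g = r \<odot>\<^bsub>M\<^esub> MD.hcomp x (inv\<^bsub>G\<^esub> h \<otimes>\<^bsub>G\<^esub> g)"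
proof -
  have "h \<otimes>\<^bsub>G\<^esub> (inv\<^bsub>G\<^esub> h \<otimes>\<^bsub>G\<^esub> g) = g" using h g by (simp add: G.m_assoc[symmetric])
  then show ?thesis using hcomp_smult_left[OF assms(1-3), of "inv\<^bsub>G\<^esub> h \<otimes>\<^bsub>G\<^esub> g"] h g by simp
qed

end

lemma (in graded_ring) graded_module_regular: "graded_module G R Rd (regular_module R) Rd"
proof (intro graded_module.intro graded_ring_axioms module_regular_module graded_module_axioms.intro)
  show "internal_direct_sum (regular_module R) (carrier G) Rd"
    using ring_direct_sum unfolding internal_direct_sum_def subgroup_regular_module by simp
qed (simp_all add: ring_degree_mult)

lemma (in graded_ring) hcomp_regular_module:
  "direct_sum.hcomp (regular_module R) (carrier G) Rd = RD.hcomp"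
proof -
  interpret reg: graded_module G R Rd "regular_module R" Rd by (rule graded_module_regular)
  show ?thesis by (simp add: fun_eq_iff RD.hcomp_def reg.MD.hcomp_def)
qed

section \<open>Products and components, the degree-zero subring, and homogeneous ideals\<close>

context graded_ring
begin

lemma hcomp_mult_right:
  assumes "r \<in> carrier R" and "k \<in> carrier G" and "x \<in> Rd k" and "h \<in> carrier G"
  shows "RD.hcomp (r \<otimes> x) (h \<otimes>\<^bsub>G\<^esub> k) = RD.hcomp r h \<otimes> x"
proof -
  interpret reg: graded_module G R Rd "regular_module R" Rd by (rule graded_module_regular)
  show ?thesis using reg.hcomp_smult_right[OF assms] by (simp add: hcomp_regular_module)
qed

lemma hcomp_mult_left':
  assumes "x \<in> carrier R" and "h \<in> carrier G" and "r \<in> Rd h" and "g \<in> carrier G"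
  shows "RD.hcomp (r \<otimes> x) g = r \<otimes> RD.hcomp x (inv\<^bsub>G\<^esub> h \<otimes>\<^bsub>G\<^esub> g)"
proof -
  interpret reg: graded_module G R Rd "regular_module R" Rd by (rule graded_module_regular)
  show ?thesis using reg.hcomp_smult_left'[of x h r g] assms by (simp add: hcomp_regular_module)
qed

text \<open>The Cauchy product; the second factor has degree g - h. It serves to isolate a single
  product of components in the primality criterion.\<close>

lemma hcomp_mult:
  assumes r: "r \<in> carrier R" and x: "x \<in> carrier R" and g: "g \<in> carrier G"
  shows "RD.hcomp (r \<otimes> x) g = (\<Oplus>h\<in>RD.supp r. RD.hcomp r h \<otimes> RD.hcomp x (inv\<^bsub>G\<^esub> h \<otimes>\<^bsub>G\<^esub> g))"
proof -
  have fin: "finite (RD.supp r)" and sub: "RD.supp r \<subseteq> carrier G"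
    using RD.finite_supp[OF r] RD.supp_subset by auto
  have c: "(\<lambda>h. RD.hcomp r h) \<in> RD.supp r \<rightarrow> carrier R" using sub RD.hcomp_closed[OF r] by auto
  have "r \<otimes> x = (\<Oplus>h\<in>RD.supp r. RD.hcomp r h) \<otimes> x"
    using RD.hcomp_sum[OF r fin subset_refl sub] by simp
  also have "\<dots> = (\<Oplus>h\<in>RD.supp r. RD.hcomp r h \<otimes> x)" using finsum_ldistr[OF fin x c] .
  finally have "RD.hcomp (r \<otimes> x) g = (\<Oplus>h\<in>RD.supp r. RD.hcomp (RD.hcomp r h \<otimes> x) g)"
    using RD.hcomp_distrib_finsum[OF fin _ g, of "\<lambda>h. RD.hcomp r h \<otimes> x"] c x by (simp add: Pi_iff)
  also have "\<dots> = (\<Oplus>h\<in>RD.supp r. RD.hcomp r h \<otimes> RD.hcomp x (inv\<^bsub>G\<^esub> h \<otimes>\<^bsub>G\<^esub> g))"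
  proof (rule finsum_cong')
    show "RD.hcomp (RD.hcomp r h \<otimes> x) g = RD.hcomp r h \<otimes> RD.hcomp x (inv\<^bsub>G\<^esub> h \<otimes>\<^bsub>G\<^esub> g)"
      if "h \<in> RD.supp r" for h
      using that sub RD.hcomp_mem[OF r] x g by (intro hcomp_mult_left') auto
    show "(\<lambda>h. RD.hcomp r h \<otimes> RD.hcomp x (inv\<^bsub>G\<^esub> h \<otimes>\<^bsub>G\<^esub> g)) \<in> RD.supp r \<rightarrow> carrier R"
      using sub r x g by (auto simp: Pi_iff intro!: m_closed RD.hcomp_closed)
  qed simp
  finally show ?thesis .
qed

text \<open>Not an axiom of \<open>graded_ring\<close>, but a consequence: comparing components of
  degree k in 1 x = x shows that the degree-zero component e of 1 acts as the identity on
  homogeneous x, hence on all of \<open>R\<close>, and so e = 1.\<close>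

lemma one_degree: "\<one> \<in> Rd \<one>\<^bsub>G\<^esub>"
proof -
  define e where "e = RD.hcomp \<one> \<one>\<^bsub>G\<^esub>"
  have e: "e \<in> Rd \<one>\<^bsub>G\<^esub>" unfolding e_def by (intro RD.hcomp_mem) auto
  then have ec: "e \<in> carrier R" using RD.summand_carrier by blast
  have "e \<otimes> x = x" if "x \<in> carrier R" for x
    using that
  proof (induction x rule: RD.homogeneous_induct)
    case (homogeneous k x)
    have "RD.hcomp (\<one> \<otimes> x) (\<one>\<^bsub>G\<^esub> \<otimes>\<^bsub>G\<^esub> k) = e \<otimes> x"
      unfolding e_def using homogeneous by (intro hcomp_mult_right) auto
    moreover have "RD.hcomp (\<one> \<otimes> x) (\<one>\<^bsub>G\<^esub> \<otimes>\<^bsub>G\<^esub> k) = x"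
      using homogeneous RD.hcomp_homogeneous[of k x k] RD.summand_carrier by simp
    ultimately show ?case by simp
  qed (use ec in \<open>simp_all add: r_distr\<close>)
  from this[of \<one>] show ?thesis using e ec by simp
qed

abbreviation R0 where "R0 \<equiv> R\<lparr>carrier := Rd \<one>\<^bsub>G\<^esub>\<rparr>"

lemma degree_zero_carrier: "r \<in> Rd \<one>\<^bsub>G\<^esub> \<Longrightarrow> r \<in> carrier R"
  using RD.summand_carrier by blast

lemma subcring_degree_zero: "subcring (Rd \<one>\<^bsub>G\<^esub>) R"
proof (rule subcringI')
  show "subring (Rd \<one>\<^bsub>G\<^esub>) R"
  proof (rule subringI)
    show "h1 \<otimes> h2 \<in> Rd \<one>\<^bsub>G\<^esub>" if "h1 \<in> Rd \<one>\<^bsub>G\<^esub>" "h2 \<in> Rd \<one>\<^bsub>G\<^esub>" for h1 h2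
      using ring_degree_mult[of "\<one>\<^bsub>G\<^esub>" "\<one>\<^bsub>G\<^esub>" h1 h2] that by simp
  qed (use one_degree degree_zero_carrier RD.summand_add RD.summand_uminus in auto)
qed

lemma cring_degree_zero: "cring R0"
  using subcring_degree_zero subcring_iff degree_zero_carrier by blast

lemma module_degree_zero: "module R M \<Longrightarrow> module R0 M"
  by (rule moduleI) (auto simp: cring_degree_zero degree_zero_carrier module.smult_closed
      module.smult_l_distr module.smult_r_distr module.smult_assoc1 module.smult_one module.axioms(2))

lemma module_map_degree_zero: "module_map R X Y f \<Longrightarrow> module_map R0 X Y f"
  unfolding module_map_def module_map_axioms_def
  by (auto simp: module_degree_zero degree_zero_carrier)

lemma submodule_degree_zero: "submodule N R M \<Longrightarrow> submodule N R0 M"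
  unfolding submodule_def submodule_axioms_def by (auto simp: degree_zero_carrier)

lemma submodule_regular_iff: "submodule N R (regular_module R) \<longleftrightarrow> ideal N R"
proof
  assume N: "submodule N R (regular_module R)"
  interpret module R "regular_module R" by (rule module_regular_module)
  show "ideal N R"
  proof (rule idealI)
    show "subgroup N (add_monoid R)" using N unfolding submodule_def subgroup_regular_module by simp
    show "x \<otimes> a \<in> N" if "a \<in> N" "x \<in> carrier R" for a x
      using submoduleE(4)[OF N, of x a] that by simp
    then show "a \<otimes> x \<in> N" if "a \<in> N" "x \<in> carrier R" for a x
      using submoduleE(1)[OF N] that m_comm[of a x] by auto
  qed (rule ring_axioms)
next
  assume N: "ideal N R"
  then show "submodule N R (regular_module R)"
    unfolding submodule_def submodule_axioms_def subgroup_regular_module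
    by (simp add: ideal.I_l_closed additive_subgroup.a_subgroup[OF ideal.axioms(1)])
qed

text \<open>Componentwise counterpart of \<open>homogeneous_ideal\<close>, which speaks of
  generators; \<open>homogeneous_ideal_iff\<close> identifies the two. This version hands over
  components directly.\<close>

definition homogeneous :: "'a set \<Rightarrow> bool" where
  "homogeneous I \<longleftrightarrow> ideal I R \<and> (\<forall>x\<in>I. \<forall>g\<in>carrier G. RD.hcomp x g \<in> I)"

lemma ideal_hcomp_mem:
  assumes "ideal J R" and x: "x \<in> carrier R" and comp: "\<And>g. g \<in> carrier G \<Longrightarrow> RD.hcomp x g \<in> J"
  shows "x \<in> J"
proof -
  interpret J: ideal J R by fact
  have "(\<Oplus>h\<in>F. RD.hcomp x h) \<in> J" if "finite F" "F \<subseteq> carrier G" for F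
    using that
  proof (induction F rule: finite_induct)
    case (insert h F)
    then have "RD.hcomp x h \<in> carrier R" "RD.hcomp x \<in> F \<rightarrow> carrier R"
      using RD.hcomp_closed[OF x] by auto
    then show ?case using insert J.a_closed comp[of h] by simp
  qed simp
  then show ?thesis
    using RD.hcomp_sum[OF x RD.finite_supp[OF x] subset_refl RD.supp_subset]
      RD.finite_supp[OF x] RD.supp_subset by metis
qed

text \<open>The set is the largest homogeneous ideal inside \<open>I\<close>. For r of degree h, the
  g-component of r x is r times the component of x in degree g - h, which gives closure under
  homogeneous scalars; additivity does the rest.\<close>

lemma homogeneous_core:
  assumes "ideal I R"
  shows "homogeneous {x \<in> carrier R. \<forall>g\<in>carrier G. RD.hcomp x g \<in> I}"
proof -
  interpret I: ideal I R by fact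
  define T where "T = {x \<in> carrier R. \<forall>g\<in>carrier G. RD.hcomp x g \<in> I}"
  have T_add: "x \<oplus> y \<in> T" if "x \<in> T" "y \<in> T" for x y
    using that by (auto simp: T_def RD.hcomp_add)
  have T_zero: "\<zero> \<in> T" by (simp add: T_def RD.hcomp_zero)
  have T_mult: "r \<otimes> x \<in> T" if "r \<in> carrier R" and x: "x \<in> T" for r x
    using that(1)
  proof (induction r rule: RD.homogeneous_induct)
    case (homogeneous h r)
    have "RD.hcomp (r \<otimes> x) g \<in> I" if "g \<in> carrier G" for g
      using hcomp_mult_left'[of x h r g] homogeneous x that RD.summand_carrier[of h r]
      by (simp add: T_def I.I_l_closed)
    then show ?case using homogeneous x RD.summand_carrier by (auto simp: T_def)
  next
    case zero
    show ?case using x T_zero by (simp add: T_def)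
  next
    case (add r s)
    then show ?case using x T_add by (simp add: T_def l_distr)
  qed
  have "ideal T R"
  proof (rule idealI)
    show "subgroup T (add_monoid R)"
    proof (rule add.subgroupI)
      show "T \<subseteq> carrier R" by (auto simp: T_def)
      show "T \<noteq> {}" using T_zero by blast
      show "\<ominus> x \<in> T" if "x \<in> T" for x using that by (simp add: T_def RD.hcomp_uminus)
    qed (simp add: T_add)
    show "x \<otimes> r \<in> T" if "x \<in> T" "r \<in> carrier R" for x r
      using T_mult[OF that(2,1)] that m_comm[of x r] by (simp add: T_def)
  qed (rule ring_axioms, rule T_mult)
  moreover have "RD.hcomp x g \<in> T" if "x \<in> T" "g \<in> carrier G" for x g
  proof -
    have "RD.hcomp x g \<in> Rd g" using that RD.hcomp_mem by (auto simp: T_def)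
    then have "RD.hcomp (RD.hcomp x g) h \<in> I" if "h \<in> carrier G" for h
      using RD.hcomp_homogeneous[of g "RD.hcomp x g" h] that \<open>x \<in> T\<close> \<open>g \<in> carrier G\<close>
      by (simp add: T_def)
    then show ?thesis using that RD.hcomp_closed by (simp add: T_def)
  qed
  ultimately show ?thesis by (simp add: homogeneous_def T_def)
qed

text \<open>The homogeneous core of \<open>I\<close> contains every homogeneous element of
  \<open>I\<close>; if these generate \<open>I\<close>, the core is all of \<open>I\<close>. In the
  other direction an element is the sum of its components, which are homogeneous elements of
  \<open>I\<close>.\<close>

lemma homogeneous_ideal_iff: "homogeneous_ideal G R Rd I \<longleftrightarrow> homogeneous I"
proof
  assume I: "homogeneous_ideal G R Rd I"
  then interpret I: ideal I R by (simp add: homogeneous_ideal_def)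
  let ?T = "{x \<in> carrier R. \<forall>g\<in>carrier G. RD.hcomp x g \<in> I}"
  have "ideal ?T R" using homogeneous_core[OF I.is_ideal] by (simp add: homogeneous_def)
  moreover have "I \<inter> (\<Union>g\<in>carrier G. Rd g) \<subseteq> ?T"
    using RD.hcomp_homogeneous by (auto simp: RD.summand_carrier)
  ultimately have "Idl (I \<inter> (\<Union>g\<in>carrier G. Rd g)) \<subseteq> ?T" by (rule genideal_minimal)
  then have "I \<subseteq> ?T" using I unfolding homogeneous_ideal_def by (elim conjE) simp
  then show "homogeneous I" using I.is_ideal by (auto simp: homogeneous_def)
next
  assume I: "homogeneous I"
  then interpret I: ideal I R by (simp add: homogeneous_def)
  let ?H = "I \<inter> (\<Union>g\<in>carrier G. Rd g)"
  have H: "?H \<subseteq> carrier R" using I.Icarr by auto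
  interpret J: ideal "Idl ?H" R by (rule genideal_ideal[OF H])
  have "x \<in> Idl ?H" if x: "x \<in> I" for x
  proof -
    have xc: "x \<in> carrier R" using x I.Icarr by blast
    have "RD.hcomp x h \<in> Idl ?H" if h: "h \<in> carrier G" for h
    proof -
      have "RD.hcomp x h \<in> I" using I x h by (simp add: homogeneous_def)
      then have "RD.hcomp x h \<in> ?H" using RD.hcomp_mem[OF xc h] h by blast
      then show ?thesis using genideal_self[OF H] by blast
    qed
    then show ?thesis by (rule ideal_hcomp_mem[OF J.is_ideal xc])
  qed
  moreover have "Idl ?H \<subseteq> I" by (rule genideal_minimal[OF I.is_ideal]) auto
  ultimately show "homogeneous_ideal G R Rd I"
    using I.is_ideal by (auto simp: homogeneous_ideal_def)
qed

end

section \<open>Homogeneous primes\<close>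

context torsion_free_comm_group
begin

text \<open>\<open>P\<close> is the set of nonnegative elements of a total order compatible with the
  group, where a is at most b when \<open>inv a \<otimes> b\<close> lies in \<open>P\<close>. Zorn's
  lemma yields a maximal submonoid meeting its inverse only in the identity; torsion-freeness shows
  that maximality makes it total.\<close>

lemma exists_positive_cone:
  "\<exists>P \<subseteq> carrier G. \<one> \<in> P \<and> (\<forall>x\<in>P. \<forall>y\<in>P. x \<otimes> y \<in> P) \<and> (\<forall>x\<in>P. inv x \<in> P \<longrightarrow> x = \<one>) \<and>
     (\<forall>x\<in>carrier G. x \<in> P \<or> inv x \<in> P)"
proof -
  define \<A> where "\<A> = {P. P \<subseteq> carrier G \<and> \<one> \<in> P \<and> (\<forall>x\<in>P. \<forall>y\<in>P. x \<otimes> y \<in> P) \<and>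
    (\<forall>x\<in>P. inv x \<in> P \<longrightarrow> x = \<one>)}"
  have "\<exists>P\<in>\<A>. \<forall>Q\<in>\<A>. P \<subseteq> Q \<longrightarrow> Q = P"
  proof (rule subset_Zorn_nonempty)
    have "{\<one>} \<in> \<A>" by (simp add: \<A>_def)
    then show "\<A> \<noteq> {}" by blast
    fix \<C> assume \<C>: "\<C> \<noteq> {}" "subset.chain \<A> \<C>"
    have sub: "\<And>C. C \<in> \<C> \<Longrightarrow> C \<in> \<A>" and lin: "\<And>C D. C \<in> \<C> \<Longrightarrow> D \<in> \<C> \<Longrightarrow> C \<subseteq> D \<or> D \<subseteq> C"
      using \<C>(2) by (auto simp: subset_chain_def)
    have two: "\<exists>C\<in>\<C>. x \<in> C \<and> y \<in> C" if xy: "x \<in> \<Union>\<C>" "y \<in> \<Union>\<C>" for x y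
    proof -
      obtain C D where "C \<in> \<C>" "x \<in> C" "D \<in> \<C>" "y \<in> D" using xy by blast
      then show ?thesis using lin[of C D] by blast
    qed
    have "x \<otimes> y \<in> \<Union>\<C>" if "x \<in> \<Union>\<C>" "y \<in> \<Union>\<C>" for x y
      using two[OF that] sub unfolding \<A>_def by blast
    moreover have "x = \<one>" if "x \<in> \<Union>\<C>" "inv x \<in> \<Union>\<C>" for x
      using two[OF that] sub unfolding \<A>_def by blast
    moreover have "\<Union>\<C> \<subseteq> carrier G" "\<one> \<in> \<Union>\<C>" using sub \<C>(1) unfolding \<A>_def by blast+
    ultimately show "\<Union>\<C> \<in> \<A>" unfolding \<A>_def by blast
  qed
  then obtain P where P: "P \<in> \<A>" and max: "\<And>Q. Q \<in> \<A> \<Longrightarrow> P \<subseteq> Q \<Longrightarrow> Q = P" by blast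
  have Pc: "P \<subseteq> carrier G" and P1: "\<one> \<in> P" and Pm: "\<And>x y. x \<in> P \<Longrightarrow> y \<in> P \<Longrightarrow> x \<otimes> y \<in> P"
    and Pp: "\<And>x. x \<in> P \<Longrightarrow> inv x \<in> P \<Longrightarrow> x = \<one>"
    using P by (auto simp: \<A>_def)
  have Ppow: "x [^] n \<in> P" if "x \<in> P" for x and n :: nat
    by (induction n) (use that P1 Pm in auto)
  have ext: "\<exists>k::nat. 0 < k \<and> inv (g [^] k) \<in> P" if g: "g \<in> carrier G" "g \<notin> P" for g
  proof -
    \<comment> \<open>\<open>Q\<close> is the submonoid generated by \<open>P\<close> and g. It is
      strictly larger than \<open>P\<close>, so by maximality it contains some y other than the
      identity together with its inverse; multiplying the two expressions makes a power of g inverse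
      to an element of \<open>P\<close>.\<close>
    define Q where "Q = {p \<otimes> g [^] n | p n. p \<in> P \<and> n \<in> (UNIV :: nat set)}"
    have QI: "p \<otimes> g [^] n \<in> Q" if "p \<in> P" for p and n :: nat using that by (auto simp: Q_def)
    have PQ: "P \<subseteq> Q"
    proof
      show "p \<in> Q" if "p \<in> P" for p using QI[OF that, of 0] that Pc by auto
    qed
    have "g \<in> Q" using QI[OF P1, of 1] g by simp
    then have "Q \<notin> \<A>" using max[of Q] PQ g by blast
    moreover have "Q \<subseteq> carrier G" using Pc g by (auto simp: Q_def)
    moreover have "\<one> \<in> Q" using PQ P1 by blast
    moreover have "x \<otimes> y \<in> Q" if xy: "x \<in> Q" "y \<in> Q" for x y
    proof -
      obtain p n where x: "x = p \<otimes> g [^] (n::nat)" "p \<in> P" using xy(1) by (auto simp: Q_def)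
      obtain q m where y: "y = q \<otimes> g [^] (m::nat)" "q \<in> P" using xy(2) by (auto simp: Q_def)
      have "p \<in> carrier G" "q \<in> carrier G" using x y Pc by auto
      then have "x \<otimes> y = (p \<otimes> q) \<otimes> g [^] (n + m)"
        using x y g by (simp add: nat_pow_mult[symmetric] m_ac)
      then show ?thesis using QI Pm x y by simp
    qed
    ultimately obtain y where y: "y \<in> Q" "inv y \<in> Q" "y \<noteq> \<one>" unfolding \<A>_def by blast
    obtain p n where pn: "y = p \<otimes> g [^] (n::nat)" "p \<in> P" using y(1) by (auto simp: Q_def)
    obtain q m where qm: "inv y = q \<otimes> g [^] (m::nat)" "q \<in> P" using y(2) by (auto simp: Q_def)
    have c: "p \<in> carrier G" "q \<in> carrier G" using pn qm Pc by auto
    have yc: "y \<in> carrier G" using pn c g by simp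
    have "y \<otimes> inv y = (p \<otimes> q) \<otimes> g [^] (n + m)"
      unfolding qm(1) unfolding pn(1) using c g by (simp add: nat_pow_mult[symmetric] m_ac)
    then have one: "(p \<otimes> q) \<otimes> g [^] (n + m) = \<one>" using yc by simp
    \<comment> \<open>If both exponents were 0, then y and its inverse would lie in \<open>P\<close>
      and y would be the identity.\<close>
    have "0 < n + m"
    proof (rule ccontr)
      assume "\<not> 0 < n + m"
      then have z: "n = 0" "m = 0" by auto
      then have "q = inv p" using one c by (metis add_0 inv_equality m_comm nat_pow_0 r_one m_closed)
      then have "p = \<one>" using Pp pn qm by blast
      then show False using pn(1) z y(3) by simp
    qed
    moreover have "inv (g [^] (n + m)) = p \<otimes> q"
      using one c g by (intro inv_equality) auto
    ultimately show ?thesis using Pm pn qm by metis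
  qed
  have Pt: "x \<in> P \<or> inv x \<in> P" if x: "x \<in> carrier G" for x
  proof (rule ccontr)
    assume n: "\<not> (x \<in> P \<or> inv x \<in> P)"
    \<comment> \<open>The two exponents k and l differ in general; raising to the complementary
      powers puts both x^(lk) and its inverse into \<open>P\<close>.\<close>
    obtain k :: nat where k: "0 < k" "inv (x [^] k) \<in> P" using ext[of x] x n by blast
    obtain l :: nat where l: "0 < l" "inv (inv x [^] l) \<in> P" using ext[of "inv x"] x n by auto
    have "inv (inv x [^] l) = x [^] l" using nat_pow_inv[OF x, of l] x by simp
    then have 1: "x [^] (l * k) \<in> P" using Ppow[OF l(2), of k] nat_pow_pow[OF x, of l k] by metis
    have "(inv (x [^] k)) [^] l = inv ((x [^] k) [^] l)" using x by (intro nat_pow_inv) simp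
    also have "(x [^] k) [^] l = x [^] (l * k)" using nat_pow_pow[OF x, of k l] by (simp only: mult.commute)
    finally have "inv (x [^] (l * k)) \<in> P" using Ppow[OF k(2), of l] by metis
    then have "x [^] (l * k) = \<one>" using Pp 1 by blast
    moreover have "0 < l * k" using k(1) l(1) by (simp only: nat_0_less_mult_iff)
    ultimately have "x = \<one>" using torsion_free[OF x] by blast
    with n P1 show False by metis
  qed
  show ?thesis by (intro exI[of _ P] conjI ballI impI) (rule Pc P1 Pm Pp Pt; assumption)+
qed

text \<open>The product of the maximal elements of \<open>A\<close> and \<open>B\<close> for the order given by a positive cone.\<close>

lemma unique_product:
  assumes "finite A" "A \<noteq> {}" "A \<subseteq> carrier G" and "finite B" "B \<noteq> {}" "B \<subseteq> carrier G"
  shows "\<exists>m\<in>A. \<exists>n\<in>B. \<forall>a\<in>A. \<forall>b\<in>B. a \<otimes> b = m \<otimes> n \<longrightarrow> a = m \<and> b = n"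
proof -
  obtain P where Pc: "P \<subseteq> carrier G" and P1: "\<one> \<in> P" and Pm: "\<And>x y. x \<in> P \<Longrightarrow> y \<in> P \<Longrightarrow> x \<otimes> y \<in> P"
    and Pp: "\<And>x. x \<in> P \<Longrightarrow> inv x \<in> P \<Longrightarrow> x = \<one>"
    and Pt: "\<And>x. x \<in> carrier G \<Longrightarrow> x \<in> P \<or> inv x \<in> P"
    using exists_positive_cone by (elim exE conjE) (simp only: Ball_def)
  \<comment> \<open>Here \<open>inv x \<otimes> m \<in> P\<close> reads as: x is at most m. So m is
    the maximum of F.\<close>
  have max: "\<exists>m\<in>F. \<forall>x\<in>F. inv x \<otimes> m \<in> P" if "finite F" "F \<noteq> {}" "F \<subseteq> carrier G" for F
    using that
  proof (induction F rule: finite_ne_induct)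
    case (singleton x)
    then show ?case using P1 by simp
  next
    case (insert x F)
    then obtain m where m: "m \<in> F" "\<And>a. a \<in> F \<Longrightarrow> inv a \<otimes> m \<in> P" by auto
    have c: "x \<in> carrier G" "m \<in> carrier G" using insert.prems m by auto
    show ?case
    proof (cases "inv x \<otimes> m \<in> P")
      case True
      then show ?thesis using m by blast
    next
      case False
      then have "inv (inv x \<otimes> m) \<in> P" using Pt[of "inv x \<otimes> m"] c by simp
      then have mx: "inv m \<otimes> x \<in> P" using c by (simp add: inv_mult_group)
      have "inv a \<otimes> x \<in> P" if a: "a \<in> insert x F" for a
      proof (cases "a = x")
        case True
        then show ?thesis using c P1 by simp
      next
        case False
        then have aF: "a \<in> F" "a \<in> carrier G" using a insert.prems by auto
        have "(inv a \<otimes> m) \<otimes> (inv m \<otimes> x) = inv a \<otimes> (m \<otimes> inv m) \<otimes> x"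
          using aF c by (simp only: m_assoc inv_closed m_closed)
        also have "\<dots> = inv a \<otimes> x" using aF c by simp
        finally show ?thesis using Pm[OF m(2)[OF aF(1)] mx] by simp
      qed
      then show ?thesis by blast
    qed
  qed
  obtain m where m: "m \<in> A" "\<And>a. a \<in> A \<Longrightarrow> inv a \<otimes> m \<in> P" using max[OF assms(1-3)] by blast
  obtain n where n: "n \<in> B" "\<And>a. a \<in> B \<Longrightarrow> inv a \<otimes> n \<in> P" using max[OF assms(4-6)] by blast
  have "a = m \<and> b = n" if ab: "a \<in> A" "b \<in> B" "a \<otimes> b = m \<otimes> n" for a b
  proof -
    have c: "a \<in> carrier G" "b \<in> carrier G" "m \<in> carrier G" "n \<in> carrier G"
      using ab m(1) n(1) assms by auto
    \<comment> \<open>The nonnegative gaps from a to m and from b to n have trivial product, so each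
      is the inverse of the other and both are trivial.\<close>
    have "(inv b \<otimes> n) \<otimes> (inv a \<otimes> m) = inv (a \<otimes> b) \<otimes> (m \<otimes> n)"
      using c by (simp add: inv_mult m_ac)
    also have "\<dots> = \<one>" unfolding ab(3) using c by simp
    finally have "inv (inv a \<otimes> m) = inv b \<otimes> n" using c by (intro inv_equality) auto
    then have "inv a \<otimes> m = \<one>" using Pp[of "inv a \<otimes> m"] m(2)[OF ab(1)] n(2)[OF ab(2)] by simp
    then have am: "a = m" using c by (metis inv_closed inv_equality inv_inv m_comm)
    then show ?thesis using ab(3) c by simp
  qed
  then show ?thesis using m(1) n(1) by blast
qed

end

text \<open>In a Noetherian ring a nonempty chain of ideals contains its own union, so Zorn's lemma
  applies to every nonempty family of ideals.\<close>

lemma (in noetherian_ring) exists_maximal_ideal_in: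
  assumes "\<J> \<noteq> {}" and "\<And>I. I \<in> \<J> \<Longrightarrow> ideal I R"
  shows "\<exists>I\<in>\<J>. \<forall>J\<in>\<J>. I \<subseteq> J \<longrightarrow> J = I"
proof (rule subset_Zorn_nonempty[OF assms(1)])
  fix \<C> assume \<C>: "\<C> \<noteq> {}" "subset.chain \<J> \<C>"
  then have "subset.chain {I. ideal I R} \<C>" using assms(2) by (auto simp: subset_chain_def)
  then show "\<Union>\<C> \<in> \<J>" using ideal_chain_is_trivial[OF \<C>(1)] \<C>(2) by (auto simp: subset_chain_def)
qed

text \<open>Zorn's lemma is stated for maximal sets, so it is applied to complements in the carrier.
  Chains are bounded because the intersection of a chain of primes is prime: if one member misses a
  and another misses b, the smaller of the two misses both.\<close>

lemma (in cring) exists_minimal_prime_below: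
  assumes Q: "Q \<in> primes_over R A"
  shows "\<exists>P\<in>minimal_primes_over R A. P \<subseteq> Q"
proof -
  define \<P> where "\<P> = {P \<in> primes_over R A. P \<subseteq> Q}"
  have pr: "primeideal P R" and Psub: "P \<subseteq> carrier R" if "P \<in> \<P>" for P
  proof -
    show 1: "primeideal P R" using that by (simp add: \<P>_def primes_over_def)
    show "P \<subseteq> carrier R"
      using ideal.Icarr[OF primeideal.axioms(1)[OF 1]] by blast
  qed
  have "\<exists>M\<in>(\<lambda>P. carrier R - P) ` \<P>. \<forall>X\<in>(\<lambda>P. carrier R - P) ` \<P>. M \<subseteq> X \<longrightarrow> X = M"
  proof (rule subset_Zorn_nonempty)
    show "(\<lambda>P. carrier R - P) ` \<P> \<noteq> {}" using Q by (auto simp: \<P>_def)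
    fix \<C> assume \<C>: "\<C> \<noteq> {}" "subset.chain ((\<lambda>P. carrier R - P) ` \<P>) \<C>"
    define \<D> where "\<D> = {P \<in> \<P>. carrier R - P \<in> \<C>}"
    have \<C>_eq: "\<C> = (\<lambda>P. carrier R - P) ` \<D>"
      using \<C>(2) by (auto simp: subset_chain_def \<D>_def)
    have ne: "\<D> \<noteq> {}" using \<C>(1) \<C>_eq by blast
    have lin: "P1 \<subseteq> P2 \<or> P2 \<subseteq> P1" if "P1 \<in> \<D>" "P2 \<in> \<D>" for P1 P2
    proof -
      have "carrier R - P1 \<subseteq> carrier R - P2 \<or> carrier R - P2 \<subseteq> carrier R - P1"
        using \<C>(2) that by (simp add: subset_chain_def \<D>_def)
      then show ?thesis using Psub[of P1] Psub[of P2] that by (auto simp: \<D>_def)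
    qed
    have "primeideal (\<Inter>\<D>) R"
    proof (rule primeidealI)
      show "ideal (\<Inter>\<D>) R"
        using ne pr by (intro i_Intersect) (auto simp: \<D>_def intro: primeideal.axioms(1))
      show "cring R" by (rule is_cring)
      obtain P where P: "P \<in> \<D>" using ne by blast
      then have "carrier R \<noteq> P" "P \<subseteq> carrier R"
        using primeideal.I_notcarr[OF pr] Psub by (auto simp: \<D>_def)
      then show "carrier R \<noteq> \<Inter>\<D>" using P by blast
      show "a \<in> \<Inter>\<D> \<or> b \<in> \<Inter>\<D>" if ab: "a \<in> carrier R" "b \<in> carrier R" "a \<otimes> b \<in> \<Inter>\<D>" for a b
      proof (rule ccontr)
        assume "\<not> ?thesis"
        then obtain P1 P2 where P12: "P1 \<in> \<D>" "a \<notin> P1" "P2 \<in> \<D>" "b \<notin> P2" by blast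
        then obtain P where "P \<in> \<D>" "a \<notin> P" "b \<notin> P" using lin[of P1 P2] by blast
        then show False using primeideal.I_prime[OF pr ab(1,2), of P] ab(3) by (auto simp: \<D>_def)
      qed
    qed
    then have "\<Inter>\<D> \<in> \<P>" using ne by (auto simp: \<P>_def \<D>_def primes_over_def)
    moreover have "\<Union>\<C> = carrier R - \<Inter>\<D>" unfolding \<C>_eq using ne by blast
    ultimately show "\<Union>\<C> \<in> (\<lambda>P. carrier R - P) ` \<P>" by blast
  qed
  then obtain P where P: "P \<in> \<P>"
    and max: "\<forall>X\<in>(\<lambda>P. carrier R - P) ` \<P>. carrier R - P \<subseteq> X \<longrightarrow> X = carrier R - P"
    by (elim bexE imageE) (simp only:)
  have "P' = P" if "P' \<in> primes_over R A" "P' \<subseteq> P" for P'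
  proof -
    have P': "P' \<in> \<P>" using that P by (auto simp: \<P>_def)
    then have "carrier R - P' = carrier R - P" using bspec[OF max, OF imageI[OF P']] that(2) by blast
    then show ?thesis using Psub[OF P] Psub[OF P'] by blast
  qed
  then show ?thesis using P by (auto simp: minimal_primes_over_def \<P>_def)
qed

lemma (in ideal) finsum_mem:
  "finite F \<Longrightarrow> (\<And>i. i \<in> F \<Longrightarrow> f i \<in> I) \<Longrightarrow> finsum R f F \<in> I"
  by (induction F rule: finite_induct) (auto simp: Pi_iff)

section \<open>Primality tested on homogeneous elements\<close>

context graded_ring
begin

text \<open>Suppose a and b lie outside \<open>I\<close>, and look at the finite nonempty sets of
  degrees where their components are not in \<open>I\<close>. Some product m k of such degrees
  arises in only one way, so the component of a b in that degree is the product of the components of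
  a and b in degrees m and k, up to terms of \<open>I\<close>. Hence that product lies in
  \<open>I\<close>, against the homogeneous case.\<close>

lemma homogeneous_primeI:
  assumes "torsion_free_comm_group G" and I: "homogeneous I" and "carrier R \<noteq> I"
    and prime: "\<And>g h a b. \<lbrakk>g \<in> carrier G; h \<in> carrier G; a \<in> Rd g; b \<in> Rd h; a \<otimes> b \<in> I\<rbrakk> \<Longrightarrow> a \<in> I \<or> b \<in> I"
  shows "primeideal I R"
proof (rule primeidealI)
  show idl: "ideal I R" using I by (simp add: homogeneous_def)
  interpret I: ideal I R by (rule idl)
  show "cring R" by (rule is_cring)
  show "carrier R \<noteq> I" by fact
  show "a \<in> I \<or> b \<in> I" if a: "a \<in> carrier R" and b: "b \<in> carrier R" and ab: "a \<otimes> b \<in> I" for a b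
  proof (rule ccontr)
    assume n: "\<not> (a \<in> I \<or> b \<in> I)"
    define S where "S x = {g \<in> carrier G. RD.hcomp x g \<notin> I}" for x
    have S_supp: "S x \<subseteq> RD.supp x" for x by (auto simp: S_def RD.supp_def)
    have fin: "finite (S x)" if "x \<in> carrier R" for x
      using finite_subset[OF S_supp RD.finite_supp[OF that]] .
    have ne: "S x \<noteq> {}" if "x \<in> carrier R" "x \<notin> I" for x
      using ideal_hcomp_mem[OF idl that(1)] that(2) by (auto simp: S_def)
    have Sc: "S x \<subseteq> carrier G" for x by (auto simp: S_def)
    obtain m k where m: "m \<in> S a" and k: "k \<in> S b"
      and unique: "\<And>g h. g \<in> S a \<Longrightarrow> h \<in> S b \<Longrightarrow> g \<otimes>\<^bsub>G\<^esub> h = m \<otimes>\<^bsub>G\<^esub> k \<Longrightarrow> g = m \<and> h = k"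
      using torsion_free_comm_group.unique_product[OF assms(1) fin[OF a] ne[OF a] Sc fin[OF b] ne[OF b] Sc]
        n by blast
    have mk: "m \<in> carrier G" "k \<in> carrier G" using m k Sc by auto
    define t where "t h = RD.hcomp a h \<otimes> RD.hcomp b (inv\<^bsub>G\<^esub> h \<otimes>\<^bsub>G\<^esub> (m \<otimes>\<^bsub>G\<^esub> k))" for h
    have tc: "t h \<in> carrier R" if "h \<in> carrier G" for h
      using that mk a b by (simp add: t_def RD.hcomp_closed)
    \<comment> \<open>Away from m one factor is always in \<open>I\<close>: either the component of
      a in degree h, or, by uniqueness of m and k, the partner component of b.\<close>
    have t_mem: "t h \<in> I" if h: "h \<in> carrier G" "h \<noteq> m" for h
    proof (cases "h \<in> S a")
      case True
      let ?l = "inv\<^bsub>G\<^esub> h \<otimes>\<^bsub>G\<^esub> (m \<otimes>\<^bsub>G\<^esub> k)"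
      have l: "?l \<in> carrier G" "h \<otimes>\<^bsub>G\<^esub> ?l = m \<otimes>\<^bsub>G\<^esub> k"
        using h mk by (simp_all add: G.m_assoc[symmetric])
      then have "?l \<notin> S b" using unique[OF True, of ?l] h by blast
      then have "RD.hcomp b ?l \<in> I" using l by (simp add: S_def)
      then show ?thesis using h a by (simp add: t_def I.I_l_closed RD.hcomp_closed)
    next
      case False
      then have "RD.hcomp a h \<in> I" using h by (simp add: S_def)
      then show ?thesis using h mk b by (simp add: t_def I.I_r_closed RD.hcomp_closed)
    qed
    have finA: "finite (RD.supp a)" by (rule RD.finite_supp[OF a])
    have sub: "RD.supp a \<subseteq> carrier G" by (rule RD.supp_subset)
    have "RD.hcomp (a \<otimes> b) (m \<otimes>\<^bsub>G\<^esub> k) = (\<Oplus>h\<in>RD.supp a. t h)"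
      unfolding t_def using hcomp_mult[OF a b, of "m \<otimes>\<^bsub>G\<^esub> k"] mk by simp
    also have "RD.supp a = insert m (RD.supp a - {m})" using m S_supp by blast
    also have "(\<Oplus>h\<in>insert m (RD.supp a - {m}). t h) = t m \<oplus> (\<Oplus>h\<in>RD.supp a - {m}. t h)"
      using finA sub tc mk by (intro finsum_insert) auto
    finally have eq: "RD.hcomp (a \<otimes> b) (m \<otimes>\<^bsub>G\<^esub> k) = t m \<oplus> (\<Oplus>h\<in>RD.supp a - {m}. t h)" .
    have rest: "(\<Oplus>h\<in>RD.supp a - {m}. t h) \<in> I"
      using finA sub t_mem by (intro I.finsum_mem) auto
    have "RD.hcomp (a \<otimes> b) (m \<otimes>\<^bsub>G\<^esub> k) \<in> I" using I ab mk by (simp add: homogeneous_def)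
    then have "(t m \<oplus> (\<Oplus>h\<in>RD.supp a - {m}. t h)) \<ominus> (\<Oplus>h\<in>RD.supp a - {m}. t h) \<in> I"
      unfolding eq using rest by (simp add: minus_eq)
    then have "t m \<in> I"
      using tc[OF mk(1)] I.Icarr[OF rest] by (simp add: minus_eq a_assoc r_neg)
    then have "RD.hcomp a m \<otimes> RD.hcomp b k \<in> I"
      using mk by (simp add: t_def G.m_assoc[symmetric])
    then have "RD.hcomp a m \<in> I \<or> RD.hcomp b k \<in> I"
      using prime[OF mk RD.hcomp_mem[OF a mk(1)] RD.hcomp_mem[OF b mk(2)]] by blast
    then show False using m k by (simp add: S_def)
  qed
qed

text \<open>The homogeneous core of \<open>P\<close> is prime by the homogeneous criterion, contains
  \<open>A\<close> because \<open>A\<close> is homogeneous, and lies in \<open>P\<close>; minimality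
  makes it equal to \<open>P\<close>.\<close>

lemma homogeneous_minimal_prime:
  assumes "torsion_free_comm_group G" and A: "homogeneous A" and P: "P \<in> minimal_primes_over R A"
  shows "homogeneous P"
proof -
  have Pp: "primeideal P R" and AP: "A \<subseteq> P"
    and min: "\<And>Q. primeideal Q R \<Longrightarrow> A \<subseteq> Q \<Longrightarrow> Q \<subseteq> P \<Longrightarrow> Q = P"
    using P by (auto simp: minimal_primes_over_def primes_over_def)
  interpret P: primeideal P R by (rule Pp)
  define T where "T = {x \<in> carrier R. \<forall>g\<in>carrier G. RD.hcomp x g \<in> P}"
  have T: "homogeneous T" unfolding T_def by (rule homogeneous_core[OF P.is_ideal])
  have TP: "T \<subseteq> P" using ideal_hcomp_mem[OF P.is_ideal] by (auto simp: T_def)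
  have homog: "x \<in> T" if "g \<in> carrier G" "x \<in> Rd g" "x \<in> P" for g x
    using that RD.hcomp_homogeneous[OF that(1,2)] RD.summand_carrier by (auto simp: T_def)
  have "primeideal T R"
  proof (rule homogeneous_primeI[OF assms(1) T])
    show "carrier R \<noteq> T" using TP P.I_notcarr P.Icarr by blast
    show "a \<in> T \<or> b \<in> T" if "g \<in> carrier G" "h \<in> carrier G" "a \<in> Rd g" "b \<in> Rd h" "a \<otimes> b \<in> T" for g h a b
      using P.I_prime[of a b] that homog TP RD.summand_carrier by blast
  qed
  moreover have "A \<subseteq> T"
    using A AP ideal.Icarr[of A R] by (auto simp: T_def homogeneous_def)
  ultimately show ?thesis using min[of T] TP T by blast
qed

text \<open>The component of r a in degree g + d is the g-component of r times a, so homogeneity of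
  \<open>I\<close> passes to I : a.\<close>

lemma homogeneous_colon:
  assumes I: "homogeneous I" and d: "d \<in> carrier G" and a: "a \<in> Rd d"
  shows "homogeneous {r \<in> carrier R. r \<otimes> a \<in> I}"
  unfolding homogeneous_def
proof (intro conjI ballI)
  have ac: "a \<in> carrier R" using RD.summand_carrier d a .
  interpret I: ideal I R using I by (simp add: homogeneous_def)
  show "ideal {r \<in> carrier R. r \<otimes> a \<in> I} R"
  proof (rule idealI)
    show "subgroup {r \<in> carrier R. r \<otimes> a \<in> I} (add_monoid R)"
    proof (rule add.subgroupI)
      show "{r \<in> carrier R. r \<otimes> a \<in> I} \<noteq> {}" using ac by (auto intro!: exI[of _ \<zero>])
    qed (auto simp: ac l_distr l_minus)
    show "x \<otimes> r \<in> {r \<in> carrier R. r \<otimes> a \<in> I}" if "r \<in> {r \<in> carrier R. r \<otimes> a \<in> I}" "x \<in> carrier R" for r x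
      using that ac by (simp add: m_assoc I.I_l_closed)
    then show "r \<otimes> x \<in> {r \<in> carrier R. r \<otimes> a \<in> I}" if "r \<in> {r \<in> carrier R. r \<otimes> a \<in> I}" "x \<in> carrier R" for r x
      using that m_comm[of r x] by simp
  qed (rule ring_axioms)
  fix r g assume r: "r \<in> {r \<in> carrier R. r \<otimes> a \<in> I}" and g: "g \<in> carrier G"
  then have "RD.hcomp (r \<otimes> a) (g \<otimes>\<^bsub>G\<^esub> d) \<in> I" using I d by (simp add: homogeneous_def)
  then show "RD.hcomp r g \<in> {r \<in> carrier R. r \<otimes> a \<in> I}"
    using hcomp_mult_right[of r d a g] r g d a RD.hcomp_closed by simp
qed

end

section \<open>Modest ideals\<close>

lemma finite_length_between_refl: "finite_length_between R M V V"
  unfolding finite_length_between_def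
  by (rule bounded_chains_finite, rule finite_subset[of _ "{V}"]) auto

lemma (in module) module_length_submodule_finite_iff:
  assumes "submodule D R M"
  shows "module_length R (M\<lparr>carrier := D\<rparr>) < \<infinity> \<longleftrightarrow> finite_length_between R M {\<zero>\<^bsub>M\<^esub>} D"
proof -
  have "{N. submodule N R (M\<lparr>carrier := D\<rparr>)} = {N. submodule N R M \<and> {\<zero>\<^bsub>M\<^esub>} \<subseteq> N \<and> N \<subseteq> D}"
    using submodule_carrier_update[OF M.abelian_group_axioms submodule.axioms(1)[OF assms], where R = R]
      submodule_zero_mem by auto
  then show ?thesis unfolding module_length_finite_iff finite_length_between_def by simp
qed

lemma (in module) submodule_finsum_mem:
  assumes N: "submodule N R M" and "finite F" and "\<And>i. i \<in> F \<Longrightarrow> f i \<in> N"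
  shows "finsum M f F \<in> N"
  using assms(2,3)
proof (induction F rule: finite_induct)
  case empty
  show ?case using submodule_zero_mem[OF N] by simp
next
  case (insert i F)
  then have "f i \<in> carrier M" "f \<in> F \<rightarrow> carrier M" using submoduleE(1)[OF N] by auto
  then show ?case using insert submoduleE(5)[OF N] by simp
qed

lemma (in module_map) map_finsum:
  assumes "finite F" and "x \<in> F \<rightarrow> carrier X"
  shows "f (finsum X x F) = finsum Y (\<lambda>i. f (x i)) F"
  using assms
proof (induction F rule: finite_induct)
  case empty
  show ?case by (simp add: map_zero)
next
  case (insert i F)
  then have "x i \<in> carrier X" "x \<in> F \<rightarrow> carrier X" by auto
  moreover from this have "(\<lambda>i. f (x i)) \<in> F \<rightarrow> carrier Y" using map_closed by auto
  ultimately show ?case using insert by (simp add: map_add map_closed)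
qed

lemma (in module) smult_map:
  assumes "m \<in> carrier M"
  shows "module_map R (regular_module R) M (\<lambda>r. r \<odot>\<^bsub>M\<^esub> m)"
  using assms module_regular_module module_axioms
  by (intro module_map.intro module_map_axioms.intro) (auto simp: smult_l_distr smult_assoc1)

context graded_ring
begin

text \<open>Formulated inside \<open>R\<close>, so it applies to a prime whether or not it is known
  to be homogeneous, and enlarging the ideal only shrinks the interval. For homogeneous ideals it
  agrees with modesty of the quotient, by \<open>modest_quotient_iff\<close>.\<close>

definition modest_ideal :: "'a set \<Rightarrow> bool" where
  "modest_ideal I \<longleftrightarrow>
     (\<forall>g\<in>carrier G. finite_length_between R0 (regular_module R) (I \<inter> Rd g) (Rd g))"

lemma modest_ideal_mono: "\<lbrakk>modest_ideal I; I \<subseteq> J\<rbrakk> \<Longrightarrow> modest_ideal J"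
  unfolding modest_ideal_def by (blast intro: finite_length_between_mono)

text \<open>Ensures that an ideal which is not modest is proper, as primality of a maximal one
  requires.\<close>

lemma modest_ideal_carrier: "modest_ideal (carrier R)"
proof -
  have "carrier R \<inter> Rd g = Rd g" if "g \<in> carrier G" for g using RD.summand_carrier[OF that] by blast
  then show ?thesis by (simp add: modest_ideal_def finite_length_between_refl)
qed

lemma degree_zero_regular: "module R0 (regular_module R)"
  by (rule module_degree_zero[OF module_regular_module])

end

section \<open>Lengths of the components of \<open>M\<close> and modesty of its annihilator\<close>

context graded_module
begin

lemma degree_zero_module: "module R0 M"
  by (rule module_degree_zero[OF module_axioms])

lemma submodule_component: "g \<in> carrier G \<Longrightarrow> submodule (Md g) R0 M"
  unfolding submodule_def submodule_axioms_def
  using MD.summand_subgroup module_degree_smult[of "\<one>\<^bsub>G\<^esub>" g] by auto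

text \<open>The scalars \<open>S\<close> and the range \<open>T\<close> of coefficients are kept
  free: with \<open>R\<close> and its carrier it adjoins a generator to a graded submodule or to an
  ideal, with R_0 and its carrier it adjoins one element inside a single component.\<close>

lemma submodule_add_generator:
  assumes N: "submodule N S M" and S: "module S M" and T: "submodule T S (regular_module R)"
    and f: "module_map S (regular_module R) M (\<lambda>r. r \<odot>\<^bsub>M\<^esub> m)"
  shows "submodule {x \<oplus>\<^bsub>M\<^esub> r \<odot>\<^bsub>M\<^esub> m | x r. x \<in> N \<and> r \<in> T} S M"
proof -
  have "{x \<oplus>\<^bsub>M\<^esub> y | x y. x \<in> N \<and> y \<in> (\<lambda>r. r \<odot>\<^bsub>M\<^esub> m) ` T} = {x \<oplus>\<^bsub>M\<^esub> r \<odot>\<^bsub>M\<^esub> m | x r. x \<in> N \<and> r \<in> T}"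
    by auto
  then show ?thesis
    using module.submodule_sum[OF S N module_map.submodule_image[OF f T]] by simp
qed

lemma hcomp_add_generator:
  assumes "x \<in> carrier M" and "r \<in> carrier R" and d: "d \<in> carrier G" and m: "m \<in> Md d" and g: "g \<in> carrier G"
  shows "MD.hcomp (x \<oplus>\<^bsub>M\<^esub> r \<odot>\<^bsub>M\<^esub> m) g = MD.hcomp x g \<oplus>\<^bsub>M\<^esub> RD.hcomp r (g \<otimes>\<^bsub>G\<^esub> inv\<^bsub>G\<^esub> d) \<odot>\<^bsub>M\<^esub> m"
proof -
  have "(g \<otimes>\<^bsub>G\<^esub> inv\<^bsub>G\<^esub> d) \<otimes>\<^bsub>G\<^esub> d = g" using g d by (simp add: G.m_assoc)
  then have "MD.hcomp (r \<odot>\<^bsub>M\<^esub> m) g = RD.hcomp r (g \<otimes>\<^bsub>G\<^esub> inv\<^bsub>G\<^esub> d) \<odot>\<^bsub>M\<^esub> m"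
    using hcomp_smult_right[OF assms(2) d m, of "g \<otimes>\<^bsub>G\<^esub> inv\<^bsub>G\<^esub> d"] g d by simp
  then show ?thesis using assms MD.summand_carrier[OF d m] by (simp add: MD.hcomp_add)
qed

text \<open>With m of degree d, multiplication by m carries R_(g-d) onto (N + R m)_g modulo N_g and
  carries \<open>J\<close> into \<open>N\<close>. So the quotient is covered by the component of R /
  J in degree g - d. It is applied with \<open>J\<close> the annihilator of the module and with
  \<open>J\<close> a colon ideal.\<close>

lemma finite_length_add_generator:
  assumes N: "submodule N R M" and homog: "\<And>x g. x \<in> N \<Longrightarrow> g \<in> carrier G \<Longrightarrow> MD.hcomp x g \<in> N"
    and d: "d \<in> carrier G" and m: "m \<in> Md d"
    and J: "modest_ideal J" "\<And>r. r \<in> J \<Longrightarrow> r \<odot>\<^bsub>M\<^esub> m \<in> N" and g: "g \<in> carrier G"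
  shows "finite_length_between R0 M (N \<inter> Md g) ({x \<oplus>\<^bsub>M\<^esub> r \<odot>\<^bsub>M\<^esub> m | x r. x \<in> N \<and> r \<in> carrier R} \<inter> Md g)"
proof -
  have mc: "m \<in> carrier M" using MD.summand_carrier d m .
  have f: "module_map R0 (regular_module R) M (\<lambda>r. r \<odot>\<^bsub>M\<^esub> m)"
    by (rule module_map_degree_zero[OF smult_map[OF mc]])
  interpret reg: graded_module G R Rd "regular_module R" Rd by (rule graded_module_regular)
  define h where "h = g \<otimes>\<^bsub>G\<^esub> inv\<^bsub>G\<^esub> d"
  have h: "h \<in> carrier G" "h \<otimes>\<^bsub>G\<^esub> d = g" using g d by (simp_all add: h_def G.m_assoc)
  show ?thesis
  proof (rule module_map.finite_length_between_map[OF f])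
    show "finite_length_between R0 (regular_module R) (J \<inter> Rd h) (Rd h)"
      using J(1) h(1) by (simp add: modest_ideal_def)
    show "submodule (Rd h) R0 (regular_module R)" by (rule reg.submodule_component[OF h(1)])
    show "(\<lambda>r. r \<odot>\<^bsub>M\<^esub> m) ` (J \<inter> Rd h) \<subseteq> N \<inter> Md g"
      using J(2) module_degree_smult[OF h(1) d _ m] h(2) by auto
    fix y assume y: "y \<in> {x \<oplus>\<^bsub>M\<^esub> r \<odot>\<^bsub>M\<^esub> m | x r. x \<in> N \<and> r \<in> carrier R} \<inter> Md g"
    then obtain x r where xr: "y = x \<oplus>\<^bsub>M\<^esub> r \<odot>\<^bsub>M\<^esub> m" "x \<in> N" "r \<in> carrier R" by blast
    have xc: "x \<in> carrier M" using xr(2) submoduleE(1)[OF N] by blast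
    \<comment> \<open>Taking g-components replaces the arbitrary coefficient r by its component in
      degree g - d, and x by an element of \<open>N\<close> of degree g.\<close>
    have "y = MD.hcomp y g" using MD.hcomp_homogeneous[of g y g] y g by simp
    also have "\<dots> = MD.hcomp x g \<oplus>\<^bsub>M\<^esub> RD.hcomp r h \<odot>\<^bsub>M\<^esub> m"
      unfolding xr(1) h_def by (rule hcomp_add_generator[OF xc xr(3) d m g])
    finally show "\<exists>u\<in>N \<inter> Md g. \<exists>v\<in>Rd h. y = u \<oplus>\<^bsub>M\<^esub> v \<odot>\<^bsub>M\<^esub> m"
      using homog[OF xr(2) g] MD.hcomp_mem[OF xc g] RD.hcomp_mem[OF xr(3) h(1)] by blast
  qed auto
qed

lemma ideal_annihilator: "ideal (annihilator R M) R"
proof (rule idealI)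
  show "subgroup (annihilator R M) (add_monoid R)"
  proof (rule R.add.subgroupI)
    show "annihilator R M \<noteq> {}" by (auto simp: annihilator_def intro!: exI[of _ \<zero>])
  qed (auto simp: annihilator_def smult_l_distr smult_l_minus)
  show "s \<otimes> r \<in> annihilator R M" if "r \<in> annihilator R M" "s \<in> carrier R" for r s
    using that by (simp add: annihilator_def smult_assoc1)
  then show "r \<otimes> s \<in> annihilator R M" if "r \<in> annihilator R M" "s \<in> carrier R" for r s
    using that m_comm[of r s] by (simp add: annihilator_def)
qed (rule ring_axioms)

text \<open>For x of degree k, the g-component of r times x is the component of r x = 0 in degree g
  + k; by additivity in x that component of r kills everything.\<close>

lemma homogeneous_annihilator: "homogeneous (annihilator R M)"
  unfolding homogeneous_def
proof (intro conjI ballI ideal_annihilator)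
  fix r g assume r: "r \<in> annihilator R M" and g: "g \<in> carrier G"
  have rc: "r \<in> carrier R" using r by (simp add: annihilator_def)
  have "RD.hcomp r g \<odot>\<^bsub>M\<^esub> x = \<zero>\<^bsub>M\<^esub>" if "x \<in> carrier M" for x
    using that
  proof (induction x rule: MD.homogeneous_induct)
    case (homogeneous k x)
    then have "r \<odot>\<^bsub>M\<^esub> x = \<zero>\<^bsub>M\<^esub>" using r MD.summand_carrier by (auto simp: annihilator_def)
    then show ?case using hcomp_smult_right[OF rc homogeneous g] homogeneous g by (simp add: MD.hcomp_zero)
  qed (use rc g RD.hcomp_closed in \<open>simp_all add: smult_r_distr\<close>)
  then show "RD.hcomp r g \<in> annihilator R M" using rc g RD.hcomp_closed by (simp add: annihilator_def)
qed

text \<open>The components of a finite generating set do the job, since a submodule containing the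
  components of an element contains the element. Generation is phrased as: no proper submodule
  contains \<open>F\<close>.\<close>

lemma finite_homogeneous_generators:
  assumes "finitely_generated_module R M"
  obtains F where "finite F" and "F \<subseteq> (\<Union>g\<in>carrier G. Md g)"
    and "\<And>N. submodule N R M \<Longrightarrow> F \<subseteq> N \<Longrightarrow> N = carrier M"
proof -
  obtain S where S: "S \<subseteq> carrier M" "finite S" "carrier M = \<Inter>{N. submodule N R M \<and> S \<subseteq> N}"
    using assms unfolding finitely_generated_module_def by blast
  define F where "F = (\<Union>s\<in>S. MD.hcomp s ` MD.supp s)"
  have "finite F" unfolding F_def using S MD.finite_supp by blast
  moreover have "F \<subseteq> (\<Union>g\<in>carrier G. Md g)"
  proof
    fix x assume "x \<in> F"
    then obtain s h where "s \<in> S" "h \<in> MD.supp s" "x = MD.hcomp s h" by (auto simp: F_def)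
    then show "x \<in> (\<Union>g\<in>carrier G. Md g)" using MD.hcomp_mem[of s h] S(1) MD.supp_subset by blast
  qed
  moreover have "N = carrier M" if N: "submodule N R M" "F \<subseteq> N" for N
  proof
    have "s \<in> N" if s: "s \<in> S" for s
    proof -
      have sc: "s \<in> carrier M" using s S(1) by blast
      have "finsum M (MD.hcomp s) (MD.supp s) \<in> N"
        using N s MD.finite_supp[OF sc] by (intro submodule_finsum_mem) (auto simp: F_def)
      then show ?thesis
        using MD.hcomp_sum[OF sc MD.finite_supp[OF sc] subset_refl MD.supp_subset] by simp
    qed
    then show "carrier M \<subseteq> N" using S(3) N(1) by blast
    show "N \<subseteq> carrier M" by (rule submoduleE(1)[OF N(1)])
  qed
  ultimately show ?thesis by (rule that)
qed

lemma finite_length_of_modest_annihilator: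
  assumes "finitely_generated_module R M" and A: "modest_ideal (annihilator R M)" and "g \<in> carrier G"
  shows "finite_length_between R0 M {\<zero>\<^bsub>M\<^esub>} (Md g)"
proof -
  interpret M0: module R0 M by (rule degree_zero_module)
  obtain F where F: "finite F" "F \<subseteq> (\<Union>g\<in>carrier G. Md g)"
    and gen: "\<And>N. submodule N R M \<Longrightarrow> F \<subseteq> N \<Longrightarrow> N = carrier M"
    using finite_homogeneous_generators[OF assms(1)] by blast
  \<comment> \<open>Closure under components belongs to the invariant because adjoining the next
    generator splits elements of \<open>N\<close> by degree. The annihilator kills each generator,
    so it can serve as the ideal \<open>J\<close> at every step.\<close>
  have "\<exists>N. submodule N R M \<and> F \<subseteq> N \<and> (\<forall>x\<in>N. \<forall>g\<in>carrier G. MD.hcomp x g \<in> N) \<and>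
      (\<forall>g\<in>carrier G. finite_length_between R0 M {\<zero>\<^bsub>M\<^esub>} (N \<inter> Md g))"
    using F
  proof (induction F rule: finite_induct)
    case empty
    have "{\<zero>\<^bsub>M\<^esub>} \<inter> Md g = {\<zero>\<^bsub>M\<^esub>}" if "g \<in> carrier G" for g using MD.summand_zero[OF that] by blast
    then show ?case
      by (intro exI[of _ "{\<zero>\<^bsub>M\<^esub>}"]) (simp add: submodule_zero MD.hcomp_zero finite_length_between_refl)
  next
    case (insert m F)
    then obtain d where d: "d \<in> carrier G" "m \<in> Md d" by auto
    have mc: "m \<in> carrier M" using MD.summand_carrier d .
    obtain N where N: "submodule N R M" "F \<subseteq> N"
      and Nh: "\<And>x g. x \<in> N \<Longrightarrow> g \<in> carrier G \<Longrightarrow> MD.hcomp x g \<in> N"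
      and Nf: "\<And>g. g \<in> carrier G \<Longrightarrow> finite_length_between R0 M {\<zero>\<^bsub>M\<^esub>} (N \<inter> Md g)"
      using insert by auto
    let ?N = "{x \<oplus>\<^bsub>M\<^esub> r \<odot>\<^bsub>M\<^esub> m | x r. x \<in> N \<and> r \<in> carrier R}"
    have Nc: "x \<in> carrier M" if "x \<in> N" for x using that submoduleE(1)[OF N(1)] by blast
    have reg: "submodule (carrier R) R (regular_module R)"
      using module.carrier_is_submodule[OF module_regular_module] by simp
    have sub: "submodule ?N R M"
      by (rule submodule_add_generator[OF N(1) module_axioms reg smult_map[OF mc]])
    have NI: "x \<oplus>\<^bsub>M\<^esub> r \<odot>\<^bsub>M\<^esub> m \<in> ?N" if "x \<in> N" "r \<in> carrier R" for x r using that by blast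
    have "\<zero>\<^bsub>M\<^esub> \<oplus>\<^bsub>M\<^esub> \<one> \<odot>\<^bsub>M\<^esub> m \<in> ?N" by (rule NI) (simp_all add: submodule_zero_mem[OF N(1)])
    then have mN: "m \<in> ?N" using mc by simp
    have NN: "N \<subseteq> ?N"
    proof
      fix x assume x: "x \<in> N"
      have "x \<oplus>\<^bsub>M\<^esub> \<zero> \<odot>\<^bsub>M\<^esub> m \<in> ?N" by (rule NI[OF x]) simp
      then show "x \<in> ?N" using mc Nc[OF x] by simp
    qed
    have "MD.hcomp y g \<in> ?N" if y: "y \<in> ?N" and g: "g \<in> carrier G" for y g
    proof -
      obtain x r where xr: "y = x \<oplus>\<^bsub>M\<^esub> r \<odot>\<^bsub>M\<^esub> m" "x \<in> N" "r \<in> carrier R" using y by blast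
      show ?thesis
        unfolding xr(1) hcomp_add_generator[OF Nc[OF xr(2)] xr(3) d g]
        using xr d g by (intro NI Nh RD.hcomp_closed) auto
    qed
    moreover have "finite_length_between R0 M {\<zero>\<^bsub>M\<^esub>} (?N \<inter> Md g)" if g: "g \<in> carrier G" for g
    proof (rule M0.finite_length_between_trans[OF _ _ _ _ Nf[OF g]])
      show "finite_length_between R0 M (N \<inter> Md g) (?N \<inter> Md g)"
        using submodule_zero_mem[OF N(1)] mc
        by (intro finite_length_add_generator[OF N(1) Nh d A _ g]) (auto simp: annihilator_def)
      show "submodule (N \<inter> Md g) R0 M" "submodule (?N \<inter> Md g) R0 M"
        using M0.submodule_Int[OF submodule_degree_zero[OF N(1)] submodule_component[OF g]]
          M0.submodule_Int[OF submodule_degree_zero[OF sub] submodule_component[OF g]] by blast+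
    qed (use NN submodule_zero_mem[OF N(1)] MD.summand_zero[OF g] in auto)
    ultimately show ?case using sub N(2) NN mN by (intro exI[of _ ?N]) blast
  qed
  then obtain N where N: "submodule N R M" "F \<subseteq> N"
    "\<forall>g\<in>carrier G. finite_length_between R0 M {\<zero>\<^bsub>M\<^esub>} (N \<inter> Md g)" by blast
  have "N = carrier M" using gen N by blast
  moreover have "carrier M \<inter> Md g = Md g" using MD.summand_carrier[OF assms(3)] by blast
  ultimately show ?thesis using N(3) assms(3) by auto
qed

lemma modest_annihilator_of_finite_length:
  assumes "finitely_generated_module R M"
    and fin: "\<And>g. g \<in> carrier G \<Longrightarrow> finite_length_between R0 M {\<zero>\<^bsub>M\<^esub>} (Md g)"
  shows "modest_ideal (annihilator R M)"
  unfolding modest_ideal_def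
proof
  fix g assume g: "g \<in> carrier G"
  interpret M0: module R0 M by (rule degree_zero_module)
  interpret reg0: module R0 "regular_module R" by (rule degree_zero_regular)
  interpret reg: graded_module G R Rd "regular_module R" Rd by (rule graded_module_regular)
  obtain F where F: "finite F" "F \<subseteq> (\<Union>g\<in>carrier G. Md g)"
    and gen: "\<And>N. submodule N R M \<Longrightarrow> F \<subseteq> N \<Longrightarrow> N = carrier M"
    using finite_homogeneous_generators[OF assms(1)] by blast
  \<comment> \<open>The elements of degree g that kill F. Adding a generator m of degree d cuts K F
    down to the kernel of multiplication by m, and the quotient embeds into the component of
    \<open>M\<close> in degree g + d, which has finite length.\<close>
  define K where "K F = {r \<in> Rd g. \<forall>x\<in>F. r \<odot>\<^bsub>M\<^esub> x = \<zero>\<^bsub>M\<^esub>}" for F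
  have "submodule (K F) R0 (regular_module R) \<and> finite_length_between R0 (regular_module R) (K F) (Rd g)"
    using F
  proof (induction F rule: finite_induct)
    case empty
    show ?case using reg.submodule_component[OF g] finite_length_between_refl by (simp add: K_def)
  next
    case (insert m F)
    then obtain d where d: "d \<in> carrier G" "m \<in> Md d" by auto
    have mc: "m \<in> carrier M" using MD.summand_carrier d .
    interpret f: module_map R0 "regular_module R" M "\<lambda>r. r \<odot>\<^bsub>M\<^esub> m"
      by (rule module_map_degree_zero[OF smult_map[OF mc]])
    have IH: "submodule (K F) R0 (regular_module R)" "finite_length_between R0 (regular_module R) (K F) (Rd g)"
      using insert by auto
    have K_insert: "K (insert m F) = {r \<in> K F. r \<odot>\<^bsub>M\<^esub> m \<in> {\<zero>\<^bsub>M\<^esub>}}" by (auto simp: K_def)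
    have sub: "submodule (K (insert m F)) R0 (regular_module R)"
      unfolding K_insert by (rule f.submodule_vimage[OF M0.submodule_zero IH(1)])
    have "finite_length_between R0 (regular_module R) (K (insert m F)) (K F)"
    proof (rule f.finite_length_between_ker[OF fin IH(1)])
      show "g \<otimes>\<^bsub>G\<^esub> d \<in> carrier G" using g d by simp
      show "(\<lambda>r. r \<odot>\<^bsub>M\<^esub> m) ` K F \<subseteq> Md (g \<otimes>\<^bsub>G\<^esub> d)"
        using module_degree_smult[OF g d(1) _ d(2)] by (auto simp: K_def)
    qed (simp add: K_insert)
    then have "finite_length_between R0 (regular_module R) (K (insert m F)) (Rd g)"
      by (rule reg0.finite_length_between_trans[OF IH(1) reg.submodule_component[OF g] _ _ _ IH(2), rotated 2])
        (auto simp: K_def)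
    then show ?case using sub by blast
  qed
  moreover have "K F \<subseteq> annihilator R M \<inter> Rd g"
  proof
    fix r assume r: "r \<in> K F"
    have rc: "r \<in> carrier R" using r RD.summand_carrier[OF g] by (simp add: K_def)
    \<comment> \<open>By commutativity the elements killed by r form a submodule; it contains the
      generators, hence is all of \<open>M\<close>.\<close>
    have "submodule {x \<in> carrier M. r \<odot>\<^bsub>M\<^esub> x = \<zero>\<^bsub>M\<^esub>} R M"
    proof (rule submoduleI)
      show "a \<odot>\<^bsub>M\<^esub> x \<in> {x \<in> carrier M. r \<odot>\<^bsub>M\<^esub> x = \<zero>\<^bsub>M\<^esub>}"
        if "a \<in> carrier R" "x \<in> {x \<in> carrier M. r \<odot>\<^bsub>M\<^esub> x = \<zero>\<^bsub>M\<^esub>}" for a x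
      proof -
        have "r \<odot>\<^bsub>M\<^esub> (a \<odot>\<^bsub>M\<^esub> x) = a \<odot>\<^bsub>M\<^esub> (r \<odot>\<^bsub>M\<^esub> x)"
          using that(2) smult_assoc1[OF rc that(1)] smult_assoc1[OF that(1) rc] m_comm[OF rc that(1)]
          by (metis (lifting) mem_Collect_eq)
        then show ?thesis using that by simp
      qed
    qed (use rc in \<open>auto simp: smult_r_distr smult_r_minus\<close>)
    moreover have "F \<subseteq> {x \<in> carrier M. r \<odot>\<^bsub>M\<^esub> x = \<zero>\<^bsub>M\<^esub>}"
      using r F(2) MD.summand_carrier by (auto simp: K_def)
    ultimately have "{x \<in> carrier M. r \<odot>\<^bsub>M\<^esub> x = \<zero>\<^bsub>M\<^esub>} = carrier M" by (rule gen)
    then show "r \<in> annihilator R M \<inter> Rd g" using r rc by (auto simp: annihilator_def K_def)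
  qed
  ultimately show "finite_length_between R0 (regular_module R) (annihilator R M \<inter> Rd g) (Rd g)"
    using finite_length_between_mono by blast
qed

end

section \<open>From minimal primes to the ideal itself\<close>

context graded_ring
begin

lemma homogeneous_add_principal:
  assumes I: "homogeneous I" and d: "d \<in> carrier G" and a: "a \<in> Rd d"
  shows "homogeneous {x \<oplus> r \<otimes> a | x r. x \<in> I \<and> r \<in> carrier R}"
  unfolding homogeneous_def
proof (intro conjI ballI)
  let ?J = "{x \<oplus> r \<otimes> a | x r. x \<in> I \<and> r \<in> carrier R}"
  interpret reg: graded_module G R Rd "regular_module R" Rd by (rule graded_module_regular)
  interpret I: ideal I R using I by (simp add: homogeneous_def)
  have ac: "a \<in> carrier (regular_module R)" using RD.summand_carrier[OF d a] by simp
  have "submodule {x \<oplus>\<^bsub>regular_module R\<^esub> r \<odot>\<^bsub>regular_module R\<^esub> a | x r. x \<in> I \<and> r \<in> carrier R}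
      R (regular_module R)"
  proof (rule reg.submodule_add_generator)
    show "submodule I R (regular_module R)" by (simp add: submodule_regular_iff I.is_ideal)
    show "submodule (carrier R) R (regular_module R)"
      using module.carrier_is_submodule[OF module_regular_module] by simp
  qed (rule module_regular_module reg.smult_map[OF ac])+
  then show "ideal ?J R" by (simp add: submodule_regular_iff)
  fix y g assume "y \<in> ?J" and g: "g \<in> carrier G"
  then obtain x r where xr: "y = x \<oplus> r \<otimes> a" "x \<in> I" "r \<in> carrier R" by blast
  let ?h = "g \<otimes>\<^bsub>G\<^esub> inv\<^bsub>G\<^esub> d"
  have "RD.hcomp y g = RD.hcomp x g \<oplus> RD.hcomp r ?h \<otimes> a"
    using reg.hcomp_add_generator[of x r d a g] xr I.Icarr d a g by (simp add: hcomp_regular_module)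
  moreover have "RD.hcomp x g \<in> I" using I xr(2) g by (simp add: homogeneous_def)
  moreover have "RD.hcomp r ?h \<in> carrier R" using xr(3) g d by (intro RD.hcomp_closed) auto
  ultimately show "RD.hcomp y g \<in> ?J" by blast
qed

text \<open>In degree g, insert (I + (a))_g between I_g and R_g. The upper step has finite length by
  modesty of I + (a); the lower one is covered by the component of R / (I : a) in degree g -
  d.\<close>

lemma modest_ideal_of_colon:
  assumes I: "homogeneous I" and d: "d \<in> carrier G" and a: "a \<in> Rd d"
    and J: "modest_ideal {x \<oplus> r \<otimes> a | x r. x \<in> I \<and> r \<in> carrier R}"
    and C: "modest_ideal {r \<in> carrier R. r \<otimes> a \<in> I}"
  shows "modest_ideal I"
  unfolding modest_ideal_def
proof
  fix g assume g: "g \<in> carrier G"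
  let ?J = "{x \<oplus> r \<otimes> a | x r. x \<in> I \<and> r \<in> carrier R}"
  interpret reg: graded_module G R Rd "regular_module R" Rd by (rule graded_module_regular)
  interpret reg0: module R0 "regular_module R" by (rule degree_zero_regular)
  interpret I: ideal I R using I by (simp add: homogeneous_def)
  have sub: "submodule N R0 (regular_module R)" if "ideal N R" for N
    using that submodule_degree_zero submodule_regular_iff by blast
  have ac: "a \<in> carrier R" using RD.summand_carrier[OF d a] .
  have "finite_length_between R0 (regular_module R) (I \<inter> Rd g)
      ({x \<oplus>\<^bsub>regular_module R\<^esub> r \<odot>\<^bsub>regular_module R\<^esub> a | x r. x \<in> I \<and> r \<in> carrier R} \<inter> Rd g)"
  proof (rule reg.finite_length_add_generator[OF _ _ d a C _ g])
    show "submodule I R (regular_module R)" by (simp add: submodule_regular_iff I.is_ideal)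
    show "reg.MD.hcomp x g \<in> I" if "x \<in> I" "g \<in> carrier G" for x g
      using that I by (simp add: hcomp_regular_module homogeneous_def)
  qed simp
  then have 1: "finite_length_between R0 (regular_module R) (I \<inter> Rd g) (?J \<inter> Rd g)" by simp
  have 2: "finite_length_between R0 (regular_module R) (?J \<inter> Rd g) (Rd g)"
    using J g by (simp add: modest_ideal_def)
  have "ideal ?J R" using homogeneous_add_principal[OF I d a] by (simp add: homogeneous_def)
  then have 3: "submodule (?J \<inter> Rd g) R0 (regular_module R)"
    by (intro reg0.submodule_Int sub reg.submodule_component[OF g])
  have "I \<subseteq> ?J"
  proof
    fix x assume x: "x \<in> I"
    then have "x = x \<oplus> \<zero> \<otimes> a" using ac I.Icarr by simp
    then show "x \<in> ?J" using x by blast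
  qed
  then show "finite_length_between R0 (regular_module R) (I \<inter> Rd g) (Rd g)"
    by (intro reg0.finite_length_between_trans[OF 3 reg.submodule_component[OF g] _ _ 1 2]) auto
qed

text \<open>Noetherian induction: a homogeneous ideal maximal among those that are not modest is prime,
  since for homogeneous \<open>a\<close>, \<open>b\<close> with \<open>a \<otimes> b \<in> I\<close> the ring \<open>R / I\<close> is an extension of
  \<open>R / (I + (a))\<close> by a shift of \<open>R / (I : a)\<close>.\<close>

lemma modest_ideal_of_minimal_primes:
  assumes "torsion_free_comm_group G" and "noetherian_ring R" and A: "homogeneous A"
    and min: "\<And>P. P \<in> minimal_primes_over R A \<Longrightarrow> modest_ideal P"
  shows "modest_ideal A"
proof (rule ccontr)
  assume nA: "\<not> modest_ideal A"
  define \<J> where "\<J> = {I. homogeneous I \<and> A \<subseteq> I \<and> \<not> modest_ideal I}"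
  have "\<J> \<noteq> {}" using nA A by (auto simp: \<J>_def)
  moreover have "ideal I R" if "I \<in> \<J>" for I using that by (simp add: \<J>_def homogeneous_def)
  ultimately obtain I where "I \<in> \<J>" and max: "\<And>J. J \<in> \<J> \<Longrightarrow> I \<subseteq> J \<Longrightarrow> J = I"
    using noetherian_ring.exists_maximal_ideal_in[OF assms(2)] by metis
  then have I: "homogeneous I" "A \<subseteq> I" "\<not> modest_ideal I" by (simp_all add: \<J>_def)
  interpret I: ideal I R using I(1) by (simp add: homogeneous_def)
  have modest: "modest_ideal J" if "homogeneous J" "I \<subseteq> J" "J \<noteq> I" for J
    using max[of J] that I(2) by (auto simp: \<J>_def)
  have "primeideal I R"
  proof (rule homogeneous_primeI[OF assms(1) I(1)])
    show "carrier R \<noteq> I" using I(3) modest_ideal_carrier by auto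
    fix g h a b
    assume gh: "g \<in> carrier G" "h \<in> carrier G" and ab: "a \<in> Rd g" "b \<in> Rd h" "a \<otimes> b \<in> I"
    have c: "a \<in> carrier R" "b \<in> carrier R" using gh ab RD.summand_carrier by auto
    show "a \<in> I \<or> b \<in> I"
    proof (rule ccontr)
      assume n: "\<not> (a \<in> I \<or> b \<in> I)"
      \<comment> \<open>Both ideals are homogeneous and strictly larger than \<open>I\<close>: the
        first contains a, the second contains b. By maximality of \<open>I\<close> both are
        modest.\<close>
      let ?J = "{x \<oplus> r \<otimes> a | x r. x \<in> I \<and> r \<in> carrier R}" and ?C = "{r \<in> carrier R. r \<otimes> a \<in> I}"
      have "a = \<zero> \<oplus> \<one> \<otimes> a" using c by simp
      then have "a \<in> ?J" using I.zero_closed one_closed by blast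
      moreover have "I \<subseteq> ?J"
      proof
        fix x assume x: "x \<in> I"
        then have "x = x \<oplus> \<zero> \<otimes> a" using c I.Icarr by simp
        then show "x \<in> ?J" using x by blast
      qed
      ultimately have 1: "modest_ideal ?J"
        using n by (intro modest homogeneous_add_principal[OF I(1) gh(1) ab(1)]) auto
      have "b \<in> ?C" using ab(3) c m_comm[OF c] by simp
      moreover have "I \<subseteq> ?C" using c I.Icarr I.I_r_closed by auto
      ultimately have 2: "modest_ideal ?C"
        using n by (intro modest homogeneous_colon[OF I(1) gh(1) ab(1)]) auto
      show False using modest_ideal_of_colon[OF I(1) gh(1) ab(1) 1 2] I(3) by blast
    qed
  qed
  then obtain P where "P \<in> minimal_primes_over R A" "P \<subseteq> I"
    using exists_minimal_prime_below[of I A] I(2) by (auto simp: primes_over_def)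
  then show False using modest_ideal_mono[OF min] I(3) by blast
qed

end

section \<open>Graded quotients\<close>

lemma quotient_module_simps [simp]:
  "carrier (quotient_module R I) = carrier (R Quot I)" "zero (quotient_module R I) = \<zero>\<^bsub>R Quot I\<^esub>"
  "add (quotient_module R I) = add (R Quot I)"
  "smult (quotient_module R I) = (\<lambda>a X. (I +>\<^bsub>R\<^esub> a) \<otimes>\<^bsub>R Quot I\<^esub> X)"
  by (simp_all add: quotient_module_def)

locale graded_ring_ideal = graded_ring + I: ideal I R for I
begin

abbreviation Q where "Q \<equiv> quotient_module R I"

abbreviation Qd where "Qd \<equiv> quotient_grading R I Rd"

sublocale Q: cring "R Quot I"
  by (rule I.quotient_is_cring[OF is_cring])

sublocale h: ring_hom_ring R "R Quot I" "(+>) I"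
  by (rule I.rcos_ring_hom_ring)

lemma module_quotient: "module R Q"
proof (rule moduleI)
  show "abelian_group Q"
  proof (rule abelian_groupI)
    show "\<exists>Y\<in>carrier Q. Y \<oplus>\<^bsub>Q\<^esub> X = \<zero>\<^bsub>Q\<^esub>" if "X \<in> carrier Q" for X
      using that Q.l_neg[of X] Q.a_inv_closed[of X] by auto
  qed (simp_all add: Q.a_ac)
qed (simp_all add: is_cring Q.l_distr Q.r_distr Q.m_assoc)

lemma module_map_quotient: "module_map R (regular_module R) Q ((+>) I)"
  using module_quotient module_regular_module
  by (intro module_map.intro module_map_axioms.intro) simp_all

sublocale q: module_map R0 "regular_module R" Q "(+>) I"
  by (rule module_map_degree_zero[OF module_map_quotient])

lemma coset_eq_iff:
  "\<lbrakk>x \<in> carrier R; y \<in> carrier R\<rbrakk> \<Longrightarrow> I +> x = I +> y \<longleftrightarrow> x \<ominus> y \<in> I"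
  using quotient_eq_iff_same_a_r_cos[OF I.is_ideal, of x y] by (simp only:)

lemma coset_zero_iff: "x \<in> carrier R \<Longrightarrow> I +> x = \<zero>\<^bsub>R Quot I\<^esub> \<longleftrightarrow> x \<in> I"
  using coset_eq_iff[of x \<zero>] by (simp add: minus_eq)

lemma coset_surj: "X \<in> carrier (R Quot I) \<Longrightarrow> \<exists>x\<in>carrier R. X = I +> x"
  unfolding FactRing_def A_RCOSETS_def' partial_object.simps by blast

lemma submodule_Qd: "g \<in> carrier G \<Longrightarrow> submodule (Qd g) R0 Q"
  unfolding quotient_grading_def
  by (rule q.submodule_image)
    (rule graded_module.submodule_component[OF graded_module_regular])

text \<open>The coset map sends R_g onto the g-component of the quotient, with kernel the part of
  \<open>I\<close> in R_g. The two directions are the two transfer principles for linear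
  maps.\<close>

lemma quotient_length_finite_iff:
  assumes g: "g \<in> carrier G"
  shows "module_length R0 (Q\<lparr>carrier := Qd g\<rparr>) < \<infinity> \<longleftrightarrow>
    finite_length_between R0 (regular_module R) (I \<inter> Rd g) (Rd g)"
proof -
  have sub: "submodule (Rd g) R0 (regular_module R)"
    by (rule graded_module.submodule_component[OF graded_module_regular g])
  have c: "x \<in> carrier R" if "x \<in> Rd g" for x using RD.summand_carrier[OF g that] .
  have "finite_length_between R0 Q {\<zero>\<^bsub>Q\<^esub>} (Qd g) \<longleftrightarrow>
    finite_length_between R0 (regular_module R) (I \<inter> Rd g) (Rd g)"
  proof
    assume "finite_length_between R0 Q {\<zero>\<^bsub>Q\<^esub>} (Qd g)"
    then show "finite_length_between R0 (regular_module R) (I \<inter> Rd g) (Rd g)"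
    proof (rule q.finite_length_between_ker[OF _ sub])
      show "(+>) I ` Rd g \<subseteq> Qd g" by (simp add: quotient_grading_def)
    qed (use c coset_zero_iff in simp)
  next
    assume "finite_length_between R0 (regular_module R) (I \<inter> Rd g) (Rd g)"
    then show "finite_length_between R0 Q {\<zero>\<^bsub>Q\<^esub>} (Qd g)"
    proof (rule q.finite_length_between_map[OF _ sub])
      show "(+>) I ` (I \<inter> Rd g) \<subseteq> {\<zero>\<^bsub>Q\<^esub>}" using c coset_zero_iff by auto
      fix Y assume "Y \<in> Qd g"
      then obtain v where "v \<in> Rd g" "Y = I +> v" by (auto simp: quotient_grading_def)
      then show "\<exists>u\<in>{\<zero>\<^bsub>Q\<^esub>}. \<exists>v\<in>Rd g. Y = u \<oplus>\<^bsub>Q\<^esub> (I +> v)" using c by auto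
    qed simp
  qed
  then show ?thesis
    using q.Y.module_length_submodule_finite_iff[OF submodule_Qd[OF g]] by simp
qed

lemma modest_ideal_of_modest_quotient: "modest_module G R Rd Q Qd \<Longrightarrow> modest_ideal I"
  using modest_module.finite_length[of G R Rd Q Qd] quotient_length_finite_iff
  by (simp add: modest_ideal_def)

text \<open>The components of a coset are the cosets of the components of a representative.
  Homogeneity of \<open>I\<close> makes this independent of the representative, since the difference
  of two representatives has all its components in \<open>I\<close>.\<close>

lemma graded_module_quotient:
  assumes "homogeneous I"
  shows "graded_module G R Rd Q Qd"
proof (intro graded_module.intro graded_ring_axioms module_quotient graded_module_axioms.intro)
  define rep where "rep X = (SOME x. x \<in> carrier R \<and> X = I +> x)" for X
  define p where "p g X = I +> RD.hcomp (rep X) g" for g X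
  have p: "p g (I +> x) = I +> RD.hcomp x g" if g: "g \<in> carrier G" and x: "x \<in> carrier R" for g x
  proof -
    have "rep (I +> x) \<in> carrier R \<and> I +> x = I +> rep (I +> x)"
      unfolding rep_def by (rule someI_ex) (use x in blast)
    then have r: "rep (I +> x) \<in> carrier R" and "x \<ominus> rep (I +> x) \<in> I"
      using coset_eq_iff x by auto
    then have "RD.hcomp (x \<ominus> rep (I +> x)) g \<in> I" using assms g by (simp add: homogeneous_def)
    then have "RD.hcomp x g \<ominus> RD.hcomp (rep (I +> x)) g \<in> I"
      using r x g by (simp add: minus_eq RD.hcomp_add RD.hcomp_uminus)
    then have "I +> RD.hcomp x g = I +> RD.hcomp (rep (I +> x)) g"
      using coset_eq_iff[OF RD.hcomp_closed[OF x g] RD.hcomp_closed[OF r g]] by blast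
    then show ?thesis by (simp only: p_def)
  qed
  show "internal_direct_sum Q (carrier G) Qd"
  proof (rule internal_direct_sumI[where p = p])
    show "abelian_group Q" by (rule module.axioms(2)[OF module_quotient])
    show "subgroup (Qd g) (add_monoid Q)" if "g \<in> carrier G" for g
      using submodule_Qd[OF that] by (simp add: submodule_def)
    show "\<exists>F f. finite F \<and> F \<subseteq> carrier G \<and> (\<forall>g\<in>F. f g \<in> Qd g) \<and> X = finsum Q f F"
      if X: "X \<in> carrier Q" for X
    proof -
      obtain x where x: "x \<in> carrier R" "X = I +> x" using X coset_surj by auto
      have "RD.hcomp x \<in> RD.supp x \<rightarrow> carrier (regular_module R)"
        using RD.hcomp_closed[OF x(1)] RD.supp_subset by auto
      then have "I +> finsum R (RD.hcomp x) (RD.supp x) = finsum Q (\<lambda>g. I +> RD.hcomp x g) (RD.supp x)"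
        using q.map_finsum[OF RD.finite_supp[OF x(1)], of "RD.hcomp x"] by simp
      then have "X = finsum Q (\<lambda>g. I +> RD.hcomp x g) (RD.supp x)"
        using RD.hcomp_sum[OF x(1) RD.finite_supp[OF x(1)] subset_refl RD.supp_subset] x(2) by simp
      moreover have "\<forall>g\<in>RD.supp x. I +> RD.hcomp x g \<in> Qd g"
        using RD.hcomp_mem[OF x(1)] RD.supp_subset by (auto simp: quotient_grading_def)
      ultimately show ?thesis using RD.finite_supp[OF x(1)] RD.supp_subset
        by (intro exI[of _ "RD.supp x"] exI[of _ "\<lambda>g. I +> RD.hcomp x g"]) (intro conjI)
    qed
    fix g assume g: "g \<in> carrier G"
    show "p g X \<in> carrier Q" if X: "X \<in> carrier Q" for X
    proof -
      obtain x where x: "x \<in> carrier R" "X = I +> x" using X coset_surj by auto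
      then show ?thesis using p[OF g x(1)] RD.hcomp_closed[OF x(1) g] by simp
    qed
    show "p g (X \<oplus>\<^bsub>Q\<^esub> Y) = p g X \<oplus>\<^bsub>Q\<^esub> p g Y" if XY: "X \<in> carrier Q" "Y \<in> carrier Q" for X Y
    proof -
      obtain x y where xy: "x \<in> carrier R" "X = I +> x" "y \<in> carrier R" "Y = I +> y"
        using XY coset_surj by (metis quotient_module_simps(1))
      then have "X \<oplus>\<^bsub>Q\<^esub> Y = I +> (x \<oplus> y)" by simp
      then have "p g (X \<oplus>\<^bsub>Q\<^esub> Y) = I +> (RD.hcomp x g \<oplus> RD.hcomp y g)"
        using p[OF g, of "x \<oplus> y"] xy g by (simp only: RD.hcomp_add a_closed)
      then show ?thesis using p[OF g] xy g by (simp add: RD.hcomp_closed)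
    qed
    show "p g X = (if g = k then X else \<zero>\<^bsub>Q\<^esub>)" if k: "k \<in> carrier G" and X: "X \<in> Qd k" for k X
    proof -
      obtain x where x: "x \<in> Rd k" "X = I +> x" using X by (auto simp: quotient_grading_def)
      then show ?thesis
        using p[OF g] RD.summand_carrier[OF k x(1)] RD.hcomp_homogeneous[OF k x(1) g] by simp
    qed
  qed
  show "a \<odot>\<^bsub>Q\<^esub> X \<in> Qd (g \<otimes>\<^bsub>G\<^esub> k)"
    if gk: "g \<in> carrier G" "k \<in> carrier G" and aX: "a \<in> Rd g" "X \<in> Qd k" for g k a X
  proof -
    obtain x where x: "x \<in> Rd k" "X = I +> x" using aX(2) by (auto simp: quotient_grading_def)
    then have "a \<odot>\<^bsub>Q\<^esub> X = I +> (a \<otimes> x)" using RD.summand_carrier gk aX(1) x(1) by simp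
    then show ?thesis using ring_degree_mult[OF gk aX(1) x(1)] by (simp add: quotient_grading_def)
  qed
qed

lemma modest_quotient_iff:
  assumes "homogeneous I"
  shows "modest_module G R Rd Q Qd \<longleftrightarrow> modest_ideal I"
  using modest_ideal_of_modest_quotient graded_module_quotient[OF assms] quotient_length_finite_iff
  by (auto simp: modest_module_def modest_module_axioms_def modest_ideal_def)

abbreviation Q0 where "Q0 \<equiv> (R Quot I)\<lparr>carrier := Qd \<one>\<^bsub>G\<^esub>\<rparr>"

lemma cring_quotient_degree_zero: "cring Q0"
proof -
  have sub: "subring (Qd \<one>\<^bsub>G\<^esub>) (R Quot I)"
    unfolding quotient_grading_def
    by (rule h.img_is_subring[OF subcring.axioms(1)[OF subcring_degree_zero]])
  then have "subcring (Qd \<one>\<^bsub>G\<^esub>) (R Quot I)" by (rule Q.subcringI')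
  then show ?thesis using Q.subcring_iff[OF subringE(1)[OF sub]] by simp
qed

text \<open>R_0 maps onto the degree-zero part of R / I, so multiplying by elements of that ring and
  acting by scalars of R_0 are the same thing.\<close>

lemma ideal_quotient_degree_zero_iff:
  "ideal J Q0 \<longleftrightarrow> submodule J R0 Q \<and> J \<subseteq> Qd \<one>\<^bsub>G\<^esub>"
proof
  interpret Q0: cring Q0 by (rule cring_quotient_degree_zero)
  have Qd_sub: "Qd \<one>\<^bsub>G\<^esub> \<subseteq> carrier (R Quot I)"
    using q.Y.submoduleE(1)[OF submodule_Qd[OF G.one_closed]] by simp
  {
    assume "ideal J Q0"
    then interpret J: ideal J Q0 .
    have sub: "J \<subseteq> Qd \<one>\<^bsub>G\<^esub>" using J.Icarr by auto
    have smult: "r \<odot>\<^bsub>Q\<^esub> X \<in> J" if "r \<in> carrier R0" "X \<in> J" for r X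
      using J.I_l_closed[of X "I +> r"] that by (simp add: quotient_grading_def)
    have "submodule J R0 Q"
    proof (rule q.Y.submoduleI)
      show "J \<subseteq> carrier Q" using sub Qd_sub by auto
      show "\<zero>\<^bsub>Q\<^esub> \<in> J" using J.zero_closed by simp
      show "X \<oplus>\<^bsub>Q\<^esub> Y \<in> J" if "X \<in> J" "Y \<in> J" for X Y using J.a_closed[OF that] by simp
      \<comment> \<open>Negatives are formed in different records for the module, the quotient ring
        and its degree-zero part. Multiplication by -1, an element of degree zero, mediates between
        them.\<close>
      show "\<ominus>\<^bsub>Q\<^esub> X \<in> J" if X: "X \<in> J" for X
      proof -
        have Xc: "X \<in> carrier (R Quot I)" using X sub Qd_sub by blast
        have "\<ominus> \<one> \<in> Rd \<one>\<^bsub>G\<^esub>" by (rule RD.summand_uminus[OF G.one_closed one_degree])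
        then have "(\<ominus> \<one>) \<odot>\<^bsub>Q\<^esub> X \<in> J" using smult[of "\<ominus> \<one>" X] X by simp
        moreover have "(\<ominus> \<one>) \<odot>\<^bsub>Q\<^esub> X = \<ominus>\<^bsub>R Quot I\<^esub> X"
          using Xc by (simp add: Q.l_minus)
        moreover have "\<ominus>\<^bsub>Q\<^esub> X = \<ominus>\<^bsub>R Quot I\<^esub> X"
          using Xc by (intro q.Y.M.minus_equality) (simp_all add: Q.l_neg)
        ultimately show ?thesis by simp
      qed
    qed (rule smult)
    then show "submodule J R0 Q \<and> J \<subseteq> Qd \<one>\<^bsub>G\<^esub>" using sub by blast
  }
  {
    assume J: "submodule J R0 Q \<and> J \<subseteq> Qd \<one>\<^bsub>G\<^esub>"
    then have sub: "submodule J R0 Q" and Jd: "J \<subseteq> carrier Q0" by auto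
    have mult: "Y \<otimes>\<^bsub>Q0\<^esub> X \<in> J" if X: "X \<in> J" and Y: "Y \<in> carrier Q0" for X Y
    proof -
      obtain r where "r \<in> Rd \<one>\<^bsub>G\<^esub>" "Y = I +> r" using Y by (auto simp: quotient_grading_def)
      then show ?thesis using q.Y.submoduleE(4)[OF sub, of r X] X by simp
    qed
    show "ideal J Q0"
    proof (rule idealI)
      show "ring Q0" by (rule Q0.ring_axioms)
      show "subgroup J (add_monoid Q0)"
      proof (rule Q0.add.subgroupI[OF Jd])
        show "J \<noteq> {}" by (rule q.Y.submoduleE(2)[OF sub])
        show "X \<oplus>\<^bsub>Q0\<^esub> Y \<in> J" if "X \<in> J" "Y \<in> J" for X Y
          using q.Y.submoduleE(5)[OF sub that] by simp
        show "\<ominus>\<^bsub>Q0\<^esub> X \<in> J" if X: "X \<in> J" for X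
        proof -
          have Xc: "X \<in> carrier Q0" using X Jd by blast
          have "(\<ominus>\<^bsub>Q0\<^esub> \<one>\<^bsub>Q0\<^esub>) \<otimes>\<^bsub>Q0\<^esub> X = \<ominus>\<^bsub>Q0\<^esub> X"
            using Q0.l_minus[OF Q0.one_closed Xc] Q0.l_one[OF Xc] by metis
          then show ?thesis using mult[OF X Q0.a_inv_closed[OF Q0.one_closed]] by metis
        qed
      qed
      show "Y \<otimes>\<^bsub>Q0\<^esub> X \<in> J" if "X \<in> J" "Y \<in> carrier Q0" for X Y by (rule mult[OF that])
      show "X \<otimes>\<^bsub>Q0\<^esub> Y \<in> J" if XY: "X \<in> J" "Y \<in> carrier Q0" for X Y
      proof -
        have "X \<otimes>\<^bsub>Q0\<^esub> Y = Y \<otimes>\<^bsub>Q0\<^esub> X" using Q0.m_comm XY Jd by blast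
        then show ?thesis using mult[OF XY] by metis
      qed
    qed
  }
qed

text \<open>Ideals of the degree-zero ring are submodules of the component of degree zero, where
  finite length makes descending chains stationary.\<close>

lemma artinian_of_modest_ideal:
  assumes "modest_ideal I"
  shows "artinian_ring Q0"
proof (intro artinian_ring.intro cring_quotient_degree_zero artinian_ring_axioms.intro)
  fix C :: "nat \<Rightarrow> _"
  assume C: "\<And>n. ideal (C n) Q0" "\<And>n. C (Suc n) \<subseteq> C n"
  have "module_length R0 (Q\<lparr>carrier := Qd \<one>\<^bsub>G\<^esub>\<rparr>) < \<infinity>"
    using assms quotient_length_finite_iff[OF G.one_closed] by (simp add: modest_ideal_def)
  then have "bounded_chains {N. submodule N R0 (Q\<lparr>carrier := Qd \<one>\<^bsub>G\<^esub>\<rparr>)}"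
    by (simp only: module_length_finite_iff)
  then show "\<exists>n. \<forall>m\<ge>n. C m = C n"
  proof (rule bounded_chains_decseq_stable)
    show "C n \<in> {N. submodule N R0 (Q\<lparr>carrier := Qd \<one>\<^bsub>G\<^esub>\<rparr>)}" for n
      using C(1)[of n] unfolding ideal_quotient_degree_zero_iff mem_Collect_eq
        submodule_carrier_update[OF module.axioms(2)[OF module_quotient]
          submodule.axioms(1)[OF submodule_Qd[OF G.one_closed]]] .
  qed (rule C(2))
qed

end

text \<open>A submodule \<open>N\<close> of \<open>R\<^sub>g\<close> is recovered as the degree-\<open>g\<close> part of the ideal of all \<open>r\<close> with
  \<open>(s r)\<^sub>g \<in> N\<close> for every \<open>s\<close>.\<close>

lemma (in graded_ring) exists_maximal_in_component:
  assumes "noetherian_ring R" and g: "g \<in> carrier G" and "\<X> \<noteq> {}"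
    and \<X>: "\<And>N. N \<in> \<X> \<Longrightarrow> submodule N R0 (regular_module R) \<and> N \<subseteq> Rd g"
  shows "\<exists>N\<in>\<X>. \<forall>K\<in>\<X>. N \<subseteq> K \<longrightarrow> K = N"
proof -
  interpret reg0: module R0 "regular_module R" by (rule degree_zero_regular)
  define T where "T N = {r \<in> carrier R. \<forall>s\<in>carrier R. RD.hcomp (s \<otimes> r) g \<in> N}" for N
  have T_ideal: "ideal (T N) R" if "N \<in> \<X>" for N
  proof -
    have N: "submodule N R0 (regular_module R)" using \<X>[OF that] by blast
    have mult: "x \<otimes> r \<in> T N" if "r \<in> T N" "x \<in> carrier R" for r x
      using that by (simp add: T_def m_assoc[symmetric])
    show ?thesis
    proof (rule idealI)
      show "subgroup (T N) (add_monoid R)"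
      proof (rule add.subgroupI)
        have "\<zero> \<in> T N" using reg0.submodule_zero_mem[OF N] g by (simp add: T_def RD.hcomp_zero)
        then show "T N \<noteq> {}" by blast
        show "r \<oplus> s \<in> T N" if "r \<in> T N" "s \<in> T N" for r s
          using that g reg0.submoduleE(5)[OF N] by (simp add: T_def r_distr RD.hcomp_add)
        show "\<ominus> r \<in> T N" if r: "r \<in> T N" for r
        proof -
          have "RD.hcomp (s \<otimes> (\<ominus> r)) g \<in> N" if s: "s \<in> carrier R" for s
          proof -
            have "s \<otimes> (\<ominus> r) = (\<ominus> s) \<otimes> r" using r s by (simp add: T_def l_minus r_minus)
            then show ?thesis using r s by (simp add: T_def)
          qed
          then show ?thesis using r by (simp add: T_def)
        qed
      qed (auto simp: T_def)
      show "r \<otimes> x \<in> T N" if rx: "r \<in> T N" "x \<in> carrier R" for r x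
      proof -
        have "r \<otimes> x = x \<otimes> r" using rx m_comm by (simp add: T_def)
        then show ?thesis using mult[OF rx] by metis
      qed
    qed (rule ring_axioms, rule mult)
  qed
  have T_Int: "T N \<inter> Rd g = N" if "N \<in> \<X>" for N
  proof
    have N: "submodule N R0 (regular_module R)" "N \<subseteq> Rd g" using \<X>[OF that] by blast+
    show "T N \<inter> Rd g \<subseteq> N"
    proof
      fix r assume r: "r \<in> T N \<inter> Rd g"
      then have "RD.hcomp (\<one> \<otimes> r) g \<in> N" unfolding T_def by (blast intro: one_closed)
      then show "r \<in> N" using r g RD.summand_carrier[OF g, of r] RD.hcomp_homogeneous[OF g, of r g] by simp
    qed
    have "r \<in> T N" if r: "r \<in> N" for r
    proof -
      have rg: "r \<in> Rd g" "r \<in> carrier R" using r N(2) RD.summand_carrier[OF g] by auto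
      have "RD.hcomp (s \<otimes> r) g \<in> N" if s: "s \<in> carrier R" for s
      proof -
        \<comment> \<open>For r of degree g, only the degree-zero component of s contributes to
          degree g, and \<open>N\<close> is closed under R_0.\<close>
        have "RD.hcomp (s \<otimes> r) g = RD.hcomp s \<one>\<^bsub>G\<^esub> \<otimes> r"
          using hcomp_mult_right[OF s g rg(1) G.one_closed] g by simp
        then show ?thesis
          using reg0.submoduleE(4)[OF N(1), of "RD.hcomp s \<one>\<^bsub>G\<^esub>" r] RD.hcomp_mem[OF s G.one_closed] r by simp
      qed
      then show ?thesis using rg by (simp add: T_def)
    qed
    then show "N \<subseteq> T N \<inter> Rd g" using N(2) by blast
  qed
  obtain J where "J \<in> T ` \<X>" and max: "\<forall>K\<in>T ` \<X>. J \<subseteq> K \<longrightarrow> K = J"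
    using noetherian_ring.exists_maximal_ideal_in[OF assms(1), of "T ` \<X>"] T_ideal assms(3) by blast
  then obtain N where N: "N \<in> \<X>" "J = T N" by blast
  have "K = N" if K: "K \<in> \<X>" "N \<subseteq> K" for K
  proof -
    have "T N \<subseteq> T K" using K(2) by (auto simp: T_def)
    then have "T K = T N" using max K(1) N(2) by blast
    then show ?thesis using T_Int[OF K(1)] T_Int[OF N(1)] by blast
  qed
  then show ?thesis using N(1) by blast
qed

section \<open>From an Artinian degree-zero ring to finite length in every degree\<close>

context graded_ring_ideal
begin

text \<open>Without a minimal member there is a strictly descending sequence in the family. Its
  images are ideals of the Artinian ring and become stationary; since every member contains the part
  of \<open>I\<close> in degree zero, equality of images forces equality of the members
  themselves.\<close>

lemma exists_minimal_in_degree_zero: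
  assumes "artinian_ring Q0" and "\<X> \<noteq> {}"
    and \<X>: "\<And>N. N \<in> \<X> \<Longrightarrow> submodule N R0 (regular_module R) \<and> I \<inter> Rd \<one>\<^bsub>G\<^esub> \<subseteq> N \<and> N \<subseteq> Rd \<one>\<^bsub>G\<^esub>"
  shows "\<exists>N\<in>\<X>. \<forall>K\<in>\<X>. K \<subseteq> N \<longrightarrow> K = N"
proof (rule ccontr)
  assume "\<not> ?thesis"
  then have "\<forall>N\<in>\<X>. \<exists>K. K \<in> \<X> \<and> K \<subset> N" by blast
  from bchoice[OF this] obtain nxt where nxt: "\<forall>N\<in>\<X>. nxt N \<in> \<X> \<and> nxt N \<subset> N" by (elim exE)
  obtain N0 where N0: "N0 \<in> \<X>" using assms(2) by blast
  define C where "C n = (nxt ^^ n) N0" for n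
  have C: "C n \<in> \<X>" for n 
  proof (induction n)
    case 0
    show ?case using N0 by (simp add: C_def)
  next
    case (Suc n)
    have "C (Suc n) = nxt (C n)" by (simp add: C_def)
    then show ?case using bspec[OF nxt Suc] by (simp only:)
  qed
  have C_Suc: "C (Suc n) \<subset> C n" for n 
  proof -
    have "C (Suc n) = nxt (C n)" by (simp add: C_def)
    then show ?thesis using bspec[OF nxt C[of n]] by (simp only:)
  qed
  have sub: "submodule (C n) R0 (regular_module R)" "I \<inter> Rd \<one>\<^bsub>G\<^esub> \<subseteq> C n" "C n \<subseteq> Rd \<one>\<^bsub>G\<^esub>" for n
    using \<X>[OF C[of n]] by simp_all
  have "ideal ((+>) I ` C n) Q0" for n
    unfolding ideal_quotient_degree_zero_iff unfolding quotient_grading_def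
    by (intro conjI q.submodule_image image_mono sub)
  moreover have "(+>) I ` C (Suc n) \<subseteq> (+>) I ` C n" for n
    by (intro image_mono psubset_imp_subset C_Suc)
  ultimately have "\<exists>n. \<forall>m\<ge>n. (+>) I ` C m = (+>) I ` C n"
    by (rule artinian_ring.descending_chain_condition[OF assms(1)])
  then obtain n where n: "\<forall>m\<ge>n. (+>) I ` C m = (+>) I ` C n" by (elim exE)
  have eq: "(+>) I ` C (Suc n) = (+>) I ` C n" by (rule n[rule_format]) (rule le_SucI, rule order_refl)
  \<comment> \<open>If x and y have the same coset, x - y lies in the degree-zero part of
    \<open>I\<close>, which is contained in \<open>C (Suc n)\<close>; so x = y + (x - y) does
    too.\<close>
  have "x \<in> C (Suc n)" if x: "x \<in> C n" for x
  proof -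
    have "I +> x \<in> (+>) I ` C (Suc n)" unfolding eq using x by (rule imageI)
    then obtain y where y: "I +> x = I +> y" "y \<in> C (Suc n)" by (rule imageE)
    have xy: "x \<in> Rd \<one>\<^bsub>G\<^esub>" "y \<in> Rd \<one>\<^bsub>G\<^esub>" using sub(3)[of n] sub(3)[of "Suc n"] x y(2) by auto
    then have c: "x \<in> carrier R" "y \<in> carrier R" using degree_zero_carrier by auto
    have "x \<ominus> y \<in> I" using coset_eq_iff[OF c] y(1) by blast
    moreover have "x \<ominus> y \<in> Rd \<one>\<^bsub>G\<^esub>"
      unfolding minus_eq using xy by (intro RD.summand_add RD.summand_uminus) auto
    ultimately have "x \<ominus> y \<in> C (Suc n)" using sub(2)[of "Suc n"] by blast
    then have "y \<oplus> (x \<ominus> y) \<in> C (Suc n)" using q.X.submoduleE(5)[OF sub(1) y(2), of "x \<ominus> y"] by simp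
    then show ?thesis using add_minus_cancel(2)[OF c(2,1)] by simp
  qed
  then show False using C_Suc[of n] by blast
qed

text \<open>In degree zero the quotient is Artinian and Noetherian, so it has finite length.  Each other
  component is a Noetherian module over it, and adjoining one element raises the length by at most
  that of degree zero.\<close>

lemma modest_ideal_of_artinian:
  assumes noeth: "noetherian_ring R" and art: "artinian_ring Q0"
  shows "modest_ideal I"
proof -
  interpret reg: graded_module G R Rd "regular_module R" Rd by (rule graded_module_regular)
  have comp: "submodule (Rd g) R0 (regular_module R)" if "g \<in> carrier G" for g
    by (rule reg.submodule_component[OF that])
  have I0: "submodule (I \<inter> Rd g) R0 (regular_module R)" if "g \<in> carrier G" for g
    by (rule q.X.submodule_Int[OF submodule_degree_zero comp[OF that]])
      (simp add: submodule_regular_iff I.is_ideal)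
  \<comment> \<open>The submodules of R_g that already have finite length over the part of
    \<open>I\<close> in degree g. The family is nonempty and has a maximal member, and the aim in
    every degree is to show that this member is R_g.\<close>
  define \<X> where "\<X> g = {N. submodule N R0 (regular_module R) \<and> I \<inter> Rd g \<subseteq> N \<and> N \<subseteq> Rd g \<and>
      finite_length_between R0 (regular_module R) (I \<inter> Rd g) N}" for g
  have max: "\<exists>N\<in>\<X> g. \<forall>K\<in>\<X> g. N \<subseteq> K \<longrightarrow> K = N" if g: "g \<in> carrier G" for g
  proof (rule exists_maximal_in_component[OF noeth g])
    have "I \<inter> Rd g \<in> \<X> g" using I0[OF g] by (simp add: \<X>_def finite_length_between_refl)
    then show "\<X> g \<noteq> {}" by blast
  qed (simp add: \<X>_def)
  have extend: "K \<in> \<X> g" if "g \<in> carrier G" "N \<in> \<X> g" "N \<subseteq> K" "K \<subseteq> Rd g"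
    "submodule K R0 (regular_module R)" "finite_length_between R0 (regular_module R) N K" for g N K
    using that q.X.finite_length_between_trans[of N K "I \<inter> Rd g"] by (auto simp: \<X>_def)
  have zero: "finite_length_between R0 (regular_module R) (I \<inter> Rd \<one>\<^bsub>G\<^esub>) (Rd \<one>\<^bsub>G\<^esub>)"
  proof -
    obtain N where N: "N \<in> \<X> \<one>\<^bsub>G\<^esub>" and Nmax: "\<forall>K\<in>\<X> \<one>\<^bsub>G\<^esub>. N \<subseteq> K \<longrightarrow> K = N"
      using max[OF G.one_closed] by blast
    have Nsub: "I \<inter> Rd \<one>\<^bsub>G\<^esub> \<subseteq> N" "N \<subseteq> Rd \<one>\<^bsub>G\<^esub>" using N by (auto simp: \<X>_def)
    have "N = Rd \<one>\<^bsub>G\<^esub>"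
    proof (rule ccontr)
      assume ne: "N \<noteq> Rd \<one>\<^bsub>G\<^esub>"
      \<comment> \<open>A minimal submodule \<open>K\<close> strictly above \<open>N\<close> makes K
        / N simple: only \<open>N\<close> and \<open>K\<close> lie between them. Then
        \<open>K\<close> still has finite length over \<open>I\<close>, against maximality of
        \<open>N\<close>.\<close>
      define \<Y> where "\<Y> = {K. submodule K R0 (regular_module R) \<and> N \<subset> K \<and> K \<subseteq> Rd \<one>\<^bsub>G\<^esub>}"
      have "Rd \<one>\<^bsub>G\<^esub> \<in> \<Y>" using comp[OF G.one_closed] Nsub(2) ne by (auto simp: \<Y>_def)
      then have "\<Y> \<noteq> {}" by blast
      then have "\<exists>K\<in>\<Y>. \<forall>L\<in>\<Y>. L \<subseteq> K \<longrightarrow> L = K"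
        by (rule exists_minimal_in_degree_zero[OF art]) (use Nsub(1) in \<open>auto simp: \<Y>_def\<close>)
      then obtain K where K: "K \<in> \<Y>" and Kmin: "\<forall>L\<in>\<Y>. L \<subseteq> K \<longrightarrow> L = K" by blast
      have "{L. submodule L R0 (regular_module R) \<and> N \<subseteq> L \<and> L \<subseteq> K} \<subseteq> {N, K}"
      proof
        fix L assume "L \<in> {L. submodule L R0 (regular_module R) \<and> N \<subseteq> L \<and> L \<subseteq> K}"
        then have L: "submodule L R0 (regular_module R)" "N \<subseteq> L" "L \<subseteq> K" by blast+
        have "L \<in> \<Y>" if "L \<noteq> N" using that L K by (auto simp: \<Y>_def)
        then show "L \<in> {N, K}" using bspec[OF Kmin, of L] L(3) by blast
      qed
      then have "finite_length_between R0 (regular_module R) N K"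
        unfolding finite_length_between_def
        by (intro bounded_chains_finite) (rule finite_subset, auto)
      then have "K \<in> \<X> \<one>\<^bsub>G\<^esub>" using K by (intro extend[OF G.one_closed N]) (auto simp: \<Y>_def)
      then show False using Nmax K by (auto simp: \<Y>_def)
    qed
    then show ?thesis using N by (simp add: \<X>_def)
  qed
  show ?thesis unfolding modest_ideal_def
  proof
    fix g assume g: "g \<in> carrier G"
    obtain N where N: "N \<in> \<X> g" and Nmax: "\<forall>K\<in>\<X> g. N \<subseteq> K \<longrightarrow> K = N"
      using max[OF g] by blast
    have Nsub: "I \<inter> Rd g \<subseteq> N" "N \<subseteq> Rd g" "submodule N R0 (regular_module R)"
      using N by (auto simp: \<X>_def)
    have "b \<in> N" if b: "b \<in> Rd g" for b
    proof -
      have bc: "b \<in> carrier R" using RD.summand_carrier[OF g b] .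
      have f: "module_map R0 (regular_module R) (regular_module R) (\<lambda>r. r \<odot>\<^bsub>regular_module R\<^esub> b)"
        using module_map_degree_zero[OF reg.smult_map] bc by simp
      have rb: "r \<otimes> b \<in> Rd g" if "r \<in> Rd \<one>\<^bsub>G\<^esub>" for r
        using ring_degree_mult[OF G.one_closed g that b] g by simp
      let ?K = "{x \<oplus> r \<otimes> b | x r. x \<in> N \<and> r \<in> Rd \<one>\<^bsub>G\<^esub>}"
      have KI: "x \<oplus> r \<otimes> b \<in> ?K" if "x \<in> N" "r \<in> Rd \<one>\<^bsub>G\<^esub>" for x r using that by blast
      have Nz: "\<zero> \<in> N" using q.X.submodule_zero_mem[OF Nsub(3)] by simp
      have sub: "submodule ?K R0 (regular_module R)"
        using reg.submodule_add_generator[OF Nsub(3) degree_zero_regular comp[OF G.one_closed] f] by simp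
      have NK: "N \<subseteq> ?K"
      proof
        fix x assume x: "x \<in> N"
        have "x \<oplus> \<zero> \<otimes> b \<in> ?K" by (rule KI[OF x RD.summand_zero[OF G.one_closed]])
        moreover have "x \<oplus> \<zero> \<otimes> b = x" using bc x Nsub(2) RD.summand_carrier[OF g, of x] by auto
        ultimately show "x \<in> ?K" by (simp only:)
      qed
      have "finite_length_between R0 (regular_module R) N ?K"
      proof (rule module_map.finite_length_between_map[OF f zero comp[OF G.one_closed]])
        show "(\<lambda>r. r \<odot>\<^bsub>regular_module R\<^esub> b) ` (I \<inter> Rd \<one>\<^bsub>G\<^esub>) \<subseteq> N"
          using rb I.I_r_closed[OF _ bc] Nsub(1) by auto
      qed auto
      then have "?K \<in> \<X> g"
        using NK sub Nsub(2) rb RD.summand_add[OF g] by (intro extend[OF g N]) auto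
      then have "?K = N" using Nmax NK by blast
      moreover have "\<zero> \<oplus> \<one> \<otimes> b \<in> ?K" by (rule KI[OF Nz one_degree])
      moreover have "\<zero> \<oplus> \<one> \<otimes> b = b" using bc by simp
      ultimately show ?thesis by (simp only:)
    qed
    then have "N = Rd g" using Nsub(2) by blast
    then show "finite_length_between R0 (regular_module R) (I \<inter> Rd g) (Rd g)"
      using N by (simp add: \<X>_def)
  qed
qed

end

theorem theorem7p7:
  fixes G :: "('g, 'k) monoid_scheme"
    and R :: "('a, 'm) ring_scheme" and Rd :: "'g \<Rightarrow> 'a set"
    and M :: "('a, 'b, 'n) module_scheme" and Md :: "'g \<Rightarrow> 'b set"
  assumes "torsion_free_comm_group G"
    and "graded_ring G R Rd" and "noetherian_ring R"
    and "graded_module G R Rd M Md" and "finitely_generated_module R M"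
  shows "(modest_module G R Rd M Md \<longleftrightarrow>
          (\<forall>P \<in> minimal_primes_over R (annihilator R M).
             modest_module G R Rd (quotient_module R P) (quotient_grading R P Rd)))
       \<and> (modest_module G R Rd M Md \<longleftrightarrow>
          (\<forall>P \<in> primes_over R (annihilator R M). homogeneous_ideal G R Rd P \<longrightarrow>
             modest_module G R Rd (quotient_module R P) (quotient_grading R P Rd)))
       \<and> (modest_module G R Rd M Md \<longleftrightarrow>
          modest_module G R Rd (quotient_module R (annihilator R M))
            (quotient_grading R (annihilator R M) Rd))
       \<and> (modest_module G R Rd M Md \<longleftrightarrow>
          artinian_ring ((R Quot annihilator R M)
            \<lparr>carrier := quotient_grading R (annihilator R M) Rd \<one>\<^bsub>G\<^esub>\<rparr>))"
proof -
  interpret M: graded_module G R Rd M Md by fact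
  interpret M0: module M.R0 M by (rule M.degree_zero_module)
  let ?A = "annihilator R M"
  let ?modest = "\<lambda>I. modest_module G R Rd (quotient_module R I) (quotient_grading R I Rd)"
  have gri: "graded_ring_ideal G R Rd I" if "ideal I R" for I
    using that M.graded_ring_axioms by (simp add: graded_ring_ideal_def)
  have A: "M.homogeneous ?A" by (rule M.homogeneous_annihilator)
  interpret A: graded_ring_ideal G R Rd ?A by (rule gri[OF M.ideal_annihilator])
  \<comment> \<open>This direction is available for every ideal; the equivalence that follows is for
    homogeneous ones, where the quotient is a graded module.\<close>
  have quot: "M.modest_ideal P" if "ideal P R" "?modest P" for P
    using graded_ring_ideal.modest_ideal_of_modest_quotient[OF gri] that by blast
  have quot_iff: "?modest P \<longleftrightarrow> M.modest_ideal P" if "M.homogeneous P" for P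
    using graded_ring_ideal.modest_quotient_iff[OF gri] that M.homogeneous_def by blast
  have prime: "ideal P R" "?A \<subseteq> P" if "P \<in> primes_over R ?A" for P
    using that primeideal.axioms(1) by (auto simp: primes_over_def)
  have min: "P \<in> primes_over R ?A" "M.homogeneous P" if "P \<in> minimal_primes_over R ?A" for P
    using that M.homogeneous_minimal_prime[OF assms(1) A] by (simp_all add: minimal_primes_over_def)
  have "modest_module G R Rd M Md \<longleftrightarrow>
      (\<forall>g\<in>carrier G. finite_length_between M.R0 M {\<zero>\<^bsub>M\<^esub>} (Md g))"
    using assms(4) M0.module_length_submodule_finite_iff[OF M.submodule_component]
    by (auto simp: modest_module_def modest_module_axioms_def)
  then have M_iff: "modest_module G R Rd M Md \<longleftrightarrow> M.modest_ideal ?A"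
    using M.finite_length_of_modest_annihilator[OF assms(5)]
      M.modest_annihilator_of_finite_length[OF assms(5)] by blast
  have two: "M.modest_ideal ?A" if "\<forall>P\<in>minimal_primes_over R ?A. ?modest P"
    using M.modest_ideal_of_minimal_primes[OF assms(1,3) A] quot min(1) prime(1) that by blast
  have three: "?modest P" if "M.modest_ideal ?A" "P \<in> primes_over R ?A" "M.homogeneous P" for P
    using quot_iff[OF that(3)] M.modest_ideal_mono[OF that(1) prime(2)[OF that(2)]] by blast
  \<comment> \<open>Minimal primes over a homogeneous ideal are homogeneous primes over it. So
    \<open>three\<close> serves them as well, and condition (3) includes condition (2).\<close>
  have "M.modest_ideal ?A \<longleftrightarrow> (\<forall>P\<in>minimal_primes_over R ?A. ?modest P)"
    using two three min by blast
  moreover have "M.modest_ideal ?A \<longleftrightarrow>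
      (\<forall>P\<in>primes_over R ?A. homogeneous_ideal G R Rd P \<longrightarrow> ?modest P)"
    unfolding M.homogeneous_ideal_iff using two three min by blast
  moreover have "M.modest_ideal ?A \<longleftrightarrow> ?modest ?A" using quot_iff[OF A] by blast
  moreover have "M.modest_ideal ?A \<longleftrightarrow> artinian_ring A.Q0"
    using A.artinian_of_modest_ideal A.modest_ideal_of_artinian[OF assms(3)] by blast
  ultimately show ?thesis unfolding M_iff by (intro conjI)
qed

end
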